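(* Let $N\ge1$, and let $u$ be locally integrable on $\mathbb R^N$ with distributional gradient $\nabla u\in L^1_{\rm loc}(\mathbb R^N)$. Then $$\|\nabla u\|_{L^\infty(\mathbb R^N)}=\inf\{\lambda>0:\ \nu_0(E_{\lambda,0}[u])<\infty\},$$ where both sides may equal $+\infty$ (with $\inf\emptyset=+\infty$).
   Context: $\nu_0(E)=\iint_{(x,y)\in E,\,x\ne y}|x-y|^{-N}\,dx\,dy$ for measurable $E\subset\mathbb R^N\times\mathbb R^N$. For measurable $u$ and $\lambda>0$, $E_{\lambda,0}[u]=\{(x,y):x\ne y,\ \frac{|u(x)-u(y)|}{|x-y|}>\lambda\}$. $\|\nabla u\|_{L^\infty}$ denotes the essential supremum of the Euclidean norm $|\nabla u|$. *)

theory Defs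
  imports "HOL-Analysis.Analysis" "HOL-Probability.Essential_Supremum"
begin

fun Ck :: "nat \<Rightarrow> ('a::euclidean_space \<Rightarrow> real) \<Rightarrow> bool" where
  "Ck 0 f = continuous_on UNIV f"
| "Ck (Suc k) f = ((\<forall>x. f differentiable (at x)) \<and>
      (\<forall>i\<in>Basis. Ck k (\<lambda>x. frechet_derivative f (at x) i)))"

definition smooth_fun :: "('a::euclidean_space \<Rightarrow> real) \<Rightarrow> bool" where
  "smooth_fun f = (\<forall>k. Ck k f)"

definition test_function :: "('a::euclidean_space \<Rightarrow> real) \<Rightarrow> bool" where
  "test_function \<phi> = (smooth_fun \<phi> \<and> compact (closure {x. \<phi> x \<noteq> 0}))"

definition loc_integrable :: "('a::euclidean_space \<Rightarrow> 'b::{banach, second_countable_topology}) \<Rightarrow> bool" where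
  "loc_integrable f = (\<forall>K. compact K \<longrightarrow> set_integrable lebesgue K f)"

definition weak_gradient :: "('a::euclidean_space \<Rightarrow> real) \<Rightarrow> ('a \<Rightarrow> 'a) \<Rightarrow> bool" where
  "weak_gradient u g = (\<forall>\<phi> i. test_function \<phi> \<and> i \<in> Basis \<longrightarrow>
     (\<integral>x. u x * frechet_derivative \<phi> (at x) i \<partial>lebesgue) = - (\<integral>x. (g x \<bullet> i) * \<phi> x \<partial>lebesgue))"

definition nu0 :: "('a::euclidean_space \<times> 'a) set \<Rightarrow> ennreal" where
  "nu0 E = (\<integral>\<^sup>+ p. indicator (E \<inter> {p. fst p \<noteq> snd p}) p *
              ennreal (1 / norm (fst p - snd p) ^ DIM('a)) \<partial>(lebesgue \<Otimes>\<^sub>M lebesgue))"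

definition E_lam0 :: "('a::euclidean_space \<Rightarrow> real) \<Rightarrow> real \<Rightarrow> ('a \<times> 'a) set" where
  "E_lam0 u lam = {(x, y). x \<noteq> y \<and> \<bar>u x - u y\<bar> / norm (x - y) > lam}"

end

theory Submission
  imports Defs
begin

text \<open>After passing to Borel representatives, testing the weak gradient against translates of a
  test function gives, for each \<open>h\<close>, \<open>u (x + h) - u x = (\<integral>t\<in>{0..1}. g (x + t h) \<bullet> h)\<close> for almost
  every \<open>x\<close>. If \<open>norm g \<le> L\<close> almost everywhere, then \<open>E_lam0 u lam\<close> is therefore a null set for
  \<open>lam \<ge> L\<close>.

  Conversely, \<open>nu0 (E_lam0 u lam)\<close> is the integral of \<open>m h / norm h ^ N\<close>, where \<open>m h\<close> is the measure
  of the set of \<open>x\<close> with \<open>\<bar>u (x + h) - u x\<bar> > lam * norm h\<close>. As \<open>1 / norm h ^ N\<close> is not integrable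
  on any truncated cone at the origin, finiteness yields for each unit vector \<open>\<omega>\<close> a sequence
  \<open>h n \<rightarrow> 0\<close> with directions converging to \<open>\<omega>\<close> and \<open>m (h n) \<rightarrow> 0\<close>. Testing the difference quotients along
  \<open>h n\<close> against nonnegative test functions gives \<open>g \<bullet> \<omega> \<le> lam\<close> almost everywhere in the limit;
  a countable dense set of directions then suffices.\<close>

section \<open>Smooth bump functions\<close>

text \<open>The obstacle in the second half is that smallness of \<open>m (h n)\<close> does not
  bound the integral of the quotient over the exceptional set: \<open>u\<close> is only weakly
  differentiable and the quotients may be large there. The gradient is therefore cut at a height
  \<open>R\<close>. The part below contributes at most \<open>R\<close> times the small measure. The
  part above is averaged along segments; since a translation moves the shift from \<open>g\<close>
  to the test function, its contribution is a tail of \<open>g\<close> over one fixed ball, the same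
  for all \<open>h\<close> with \<open>norm h \<le> 1\<close>. Letting \<open>n\<close> grow first
  and \<open>R\<close> second removes both terms. Bump functions are built because inequalities
  almost everywhere are read off from nonnegative test functions, and for this indicators of open
  sets have to be approximated by them.\<close>

lemma Ck_mono: "Ck (Suc k) f \<Longrightarrow> Ck k f"
proof (induction k arbitrary: f)
  case 0
  then show ?case
    by (auto intro: differentiable_imp_continuous_on simp: differentiable_on_def
        differentiable_at_withinI)
qed auto

lemma Ck_has_derivative:
  assumes "Ck (Suc k) f"
  shows "(f has_derivative frechet_derivative f (at x)) (at x)"
  using assms by (simp add: frechet_derivative_works)

text \<open>\<open>Ck\<close> is phrased through the choice-based \<open>frechet_derivative\<close>;
  this rule lets the closure properties below supply an explicit derivative instead.\<close>

lemma CkI: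
  assumes "\<And>x. (f has_derivative f' x) (at x)" "\<And>i. i \<in> Basis \<Longrightarrow> Ck k (\<lambda>x. f' x i)"
  shows "Ck (Suc k) f"
proof -
  have "f' = (\<lambda>x. frechet_derivative f (at x))"
    using assms(1) frechet_derivative_at by fastforce
  with assms show ?thesis
    by (auto simp: differentiable_def)
qed

lemma Ck_const: "Ck k (\<lambda>x. c)"
  by (induction k arbitrary: c) (auto intro!: CkI derivative_eq_intros simp del: Ck.simps(2))

lemma Ck_add: "Ck k f \<Longrightarrow> Ck k g \<Longrightarrow> Ck k (\<lambda>x. f x + g x)"
proof (induction k arbitrary: f g)
  case (Suc k)
  show ?case
    by (rule CkI[OF has_derivative_add[OF Ck_has_derivative[OF Suc.prems(1)]
            Ck_has_derivative[OF Suc.prems(2)]]])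
      (use Suc in auto)
qed (auto intro: continuous_intros)

lemma Ck_mult: "Ck k f \<Longrightarrow> Ck k g \<Longrightarrow> Ck k (\<lambda>x. f x * g x)"
proof (induction k arbitrary: f g)
  case (Suc k)
  show ?case
    by (rule CkI[OF has_derivative_mult[OF Ck_has_derivative[OF Suc.prems(1)]
            Ck_has_derivative[OF Suc.prems(2)]]])
      (intro Ck_add Suc.IH Ck_mono[OF Suc.prems(1)] Ck_mono[OF Suc.prems(2)], use Suc.prems in auto)
qed (auto intro: continuous_intros)

lemma Ck_sum: "finite A \<Longrightarrow> (\<And>i. i \<in> A \<Longrightarrow> Ck k (f i)) \<Longrightarrow> Ck k (\<lambda>x. \<Sum>i\<in>A. f i x)"
  by (induction A rule: finite_induct) (auto intro: Ck_const Ck_add)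

lemma Ck_inner: "Ck k (\<lambda>x. x \<bullet> a)"
proof (cases k)
  case (Suc m)
  have "Ck (Suc m) (\<lambda>x. x \<bullet> a)"
    by (rule CkI[where f' = "\<lambda>_ v. v \<bullet> a"]) (auto intro!: derivative_eq_intros Ck_const)
  with Suc show ?thesis by simp
qed (auto intro: continuous_intros)

lemma Ck_translate: "Ck k f \<Longrightarrow> Ck k (\<lambda>x. f (x + v))"
proof (induction k arbitrary: f)
  case (Suc k)
  have "((\<lambda>x. f (x + v)) has_derivative frechet_derivative f (at (x + v))) (at x)" for x
    by (rule has_derivative_compose[OF _ Ck_has_derivative[OF Suc.prems], of "\<lambda>x. x + v" "\<lambda>x. x"])
      (auto intro!: derivative_eq_intros)
  then show ?case
    by (rule CkI) (use Suc in auto)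
next
  case 0
  then show ?case
    using continuous_on_compose2[of UNIV f UNIV "\<lambda>x. x + v"] by (simp add: continuous_intros)
qed

lemma Ck_norm_square: "Ck k (\<lambda>x. (x - c) \<bullet> (x - c))"
proof -
  have lin: "Ck k (\<lambda>x. (x - c) \<bullet> b)" for b
    using Ck_add[OF Ck_inner[of k b] Ck_const[of k "- (c \<bullet> b)"]] by (simp add: inner_diff_left)
  have "Ck k (\<lambda>x. \<Sum>b\<in>Basis. ((x - c) \<bullet> b) * ((x - c) \<bullet> b))"
    by (intro Ck_sum Ck_mult lin) auto
  then show ?thesis
    by (subst euclidean_inner)
qed

text \<open>The chain rule turns \<open>H n\<close> into \<open>H (Suc n)\<close>, so the induction
  on \<open>k\<close> has to run over all \<open>n\<close> at once. Taking the sequence of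
  derivatives as given covers both \<open>exp\<close> and the functions \<open>flat\<close>.\<close>

lemma Ck_compose_real:
  assumes H: "\<And>n t. (H n has_real_derivative H (Suc n) t) (at t)"
  shows "Ck k q \<Longrightarrow> Ck k (\<lambda>x. H n (q x))"
proof (induction k arbitrary: n)
  case 0
  have "continuous_on UNIV (H n)"
    using H by (meson DERIV_continuous_on has_field_derivative_at_within)
  with 0 show ?case
    by (auto intro: continuous_on_compose2)
next
  case (Suc k)
  have "((\<lambda>x. H n (q x)) has_derivative (\<lambda>v. frechet_derivative q (at x) v * H (Suc n) (q x))) (at x)" for x
    using has_derivative_compose[OF Ck_has_derivative[OF Suc.prems]
        H[of n "q x", unfolded has_field_derivative_def]] by (simp add: mult.commute)
  then show ?case
    by (rule CkI) (use Suc Ck_mono[OF Suc.prems] in \<open>auto intro!: Ck_mult\<close>)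
qed

text \<open>The derivatives of \<open>exp (- 1 / t)\<close> (extended by zero to \<open>t \<le> 0\<close>)
  have the form \<open>p (1 / t) * exp (- 1 / t)\<close> with polynomials \<open>p\<close>.\<close>

definition flat :: "real poly \<Rightarrow> real \<Rightarrow> real" where
  "flat p t = (if t > 0 then poly p (1 / t) * exp (- 1 / t) else 0)"

lemma flat_tendsto_0: "((flat p) \<longlongrightarrow> 0) (at 0)"
proof -
  \<comment> \<open>With \<open>x = 1 / t\<close> the limit from the right says that the exponential
    beats each monomial at infinity.\<close>
  have "((\<lambda>x::real. \<Sum>i\<le>degree p. coeff p i * (x ^ i / exp x)) \<longlongrightarrow> 0) at_top"
    by (intro tendsto_null_sum tendsto_mult_right_zero tendsto_power_div_exp_0)
  then have "((\<lambda>x::real. poly p x * exp (- x)) \<longlongrightarrow> 0) at_top"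
    by (simp add: poly_altdef sum_distrib_right exp_minus divide_inverse mult.assoc)
  from filterlim_compose[OF this filterlim_inverse_at_top_right]
  have R: "((\<lambda>x. poly p (1 / x) * exp (- 1 / x)) \<longlongrightarrow> 0) (at_right 0)"
    by (simp add: divide_inverse)
  have "((flat p) \<longlongrightarrow> 0) (at_right 0)"
    by (rule Lim_transform_eventually[OF R])
      (auto simp: flat_def eventually_at_right_less intro: eventually_mono[OF eventually_at_right_less[of 0]])
  moreover have "((flat p) \<longlongrightarrow> 0) (at_left 0)"
    by (rule Lim_transform_eventually[OF tendsto_const])
      (auto simp: flat_def eventually_at_filter)
  ultimately show ?thesis
    by (simp add: filterlim_split_at)
qed

text \<open>For \<open>t > 0\<close> the inner derivative contributes the factor
  \<open>1 / t\<^sup>2\<close>, which is \<open>[:0, 0, 1:]\<close> evaluated at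
  \<open>1 / t\<close>; differentiating the exponential gives \<open>p\<close>, differentiating the
  polynomial gives \<open>- pderiv p\<close>.\<close>

lemma flat_has_derivative:
  "(flat p has_real_derivative flat ([:0, 0, 1:] * (p - pderiv p)) t) (at t)"
proof -
  consider "t < 0" | "t = 0" | "t > 0" by linarith
  then show ?thesis
  proof cases
    case 1
    have "((\<lambda>_. 0) has_real_derivative 0) (at t)" by simp
    then have "(flat p has_real_derivative 0) (at t)"
      by (rule has_field_derivative_transform_within_open[of _ _ _ "{..<0}"])
        (use 1 in \<open>auto simp: flat_def\<close>)
    with 1 show ?thesis by (simp add: flat_def)
  next
    case 2
    \<comment> \<open>Dividing by \<open>y\<close> multiplies a polynomial in \<open>1 / y\<close>
      by its variable, so the difference quotient at 0 is again a \<open>flat\<close> function and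
      tends to 0.\<close>
    have "(flat p y - flat p 0) / (y - 0) = flat (pCons 0 p) y" for y
      by (simp add: flat_def field_simps)
    moreover have "flat ([:0, 0, 1:] * (p - pderiv p)) 0 = 0" by (simp add: flat_def)
    ultimately show ?thesis
      using flat_tendsto_0[of "pCons 0 p"] by (simp only: has_field_derivative_iff 2)
  next
    case 3
    have "((\<lambda>t. poly p (1 / t) * exp (- 1 / t)) has_real_derivative
        flat ([:0, 0, 1:] * (p - pderiv p)) t) (at t)"
      using 3 by (auto intro!: derivative_eq_intros DERIV_chain'[OF _ poly_DERIV]
          simp: flat_def field_simps power2_eq_square)
    then show ?thesis
      by (rule has_field_derivative_transform_within_open[of _ _ _ "{0<..}"])
        (use 3 in \<open>auto simp: flat_def\<close>)
  qed
qed

primrec flat_poly :: "nat \<Rightarrow> real poly" where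
  "flat_poly 0 = 1"
| "flat_poly (Suc n) = [:0, 0, 1:] * (flat_poly n - pderiv (flat_poly n))"

lemma smooth_flat_compose:
  assumes "smooth_fun q"
  shows "smooth_fun (\<lambda>x. flat 1 (q x))"
  using Ck_compose_real[of "\<lambda>n. flat (flat_poly n)" _ q 0] flat_has_derivative assms
  by (auto simp: smooth_fun_def)

lemma smooth_exp_compose:
  assumes "smooth_fun q"
  shows "smooth_fun (\<lambda>x. exp (q x))"
  using Ck_compose_real[of "\<lambda>n. exp" _ q 0] assms
  by (auto simp: smooth_fun_def intro: derivative_eq_intros)

definition bump :: "'a::euclidean_space \<Rightarrow> real \<Rightarrow> 'a \<Rightarrow> real" where
  "bump c r x = flat 1 (r\<^sup>2 - (x - c) \<bullet> (x - c))"

lemma smooth_bump: "smooth_fun (bump c r)"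
proof -
  have "Ck k (\<lambda>x. r\<^sup>2 + (- 1) * ((x - c) \<bullet> (x - c)))" for k
    by (intro Ck_add Ck_mult Ck_const Ck_norm_square)
  then have "smooth_fun (\<lambda>x. flat 1 (r\<^sup>2 + (- 1) * ((x - c) \<bullet> (x - c))))"
    by (intro smooth_flat_compose) (simp add: smooth_fun_def)
  then show ?thesis
    by (simp add: bump_def[abs_def])
qed

lemma bump_nonneg: "0 \<le> bump c r x"
  by (simp add: bump_def flat_def)

lemma bump_pos_iff: "r > 0 \<Longrightarrow> 0 < bump c r x \<longleftrightarrow> x \<in> ball c r"
  by (auto simp: bump_def flat_def dot_square_norm dist_norm norm_minus_commute
      intro: power_strict_mono dest: power_less_imp_less_base)

lemma bump_zero: "r > 0 \<Longrightarrow> x \<notin> ball c r \<Longrightarrow> bump c r x = 0"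
  using bump_nonneg[of c r x] bump_pos_iff[of r c x] by linarith

section \<open>Smooth approximation of indicators of open sets\<close>

text \<open>The balls are enumerated by \<open>nat\<close>, possibly with repetitions, so that
  finite sums of bumps over \<open>j < n\<close> can be formed.\<close>

lemma open_countable_Union_balls:
  fixes U :: "'a::euclidean_space set"
  assumes "open U" "U \<noteq> {}"
  obtains c :: "nat \<Rightarrow> 'a" and r :: "nat \<Rightarrow> real"
  where "\<And>n. r n > 0" "U = (\<Union>n. ball (c n) (r n))"
proof -
  define F where "F = {ball x e |x e. e > 0 \<and> ball x e \<subseteq> U}"
  have "\<And>S. S \<in> F \<Longrightarrow> open S" by (auto simp: F_def)
  then obtain F' where F': "F' \<subseteq> F" "countable F'" "\<Union>F' = \<Union>F"
    by (rule Lindelof)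
  have "U \<subseteq> \<Union>F"
  proof
    fix x assume "x \<in> U"
    then obtain e where "e > 0" "ball x e \<subseteq> U" using assms(1) openE by blast
    then show "x \<in> \<Union>F" by (auto simp: F_def intro!: exI[of _ "ball x e"])
  qed
  then have U: "\<Union>F' = U" using F' by (auto simp: F_def)
  with assms have ne: "F' \<noteq> {}" by auto
  have "\<exists>x e. from_nat_into F' n = ball x e \<and> e > 0" for n
    using subsetD[OF F'(1) from_nat_into[OF ne, of n]] by (auto simp: F_def)
  then obtain c r where cr: "\<And>n. from_nat_into F' n = ball (c n) (r n)" "\<And>n. r n > 0"
    by metis
  have "U = (\<Union>n. from_nat_into F' n)"
    using U range_from_nat_into[OF ne F'(2)] by simp
  with cr show ?thesis by (intro that[of r c]) auto
qed

text \<open>The map \<open>1 - exp (- n s)\<close> sends \<open>s = 0\<close> to 0 and drives every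
  \<open>s > 0\<close> to 1. Finite sums \<open>s n\<close> of bumps suffice, so no infinite series
  has to be differentiated: at a point of \<open>U\<close> they are eventually bounded below by the
  value \<open>b\<close> of one fixed bump.\<close>

lemma test_functions_tendsto_indicator:
  fixes U :: "'a::euclidean_space set"
  assumes "open U" "bounded U"
  obtains \<phi> :: "nat \<Rightarrow> 'a \<Rightarrow> real"
  where "\<And>n. test_function (\<phi> n)" "\<And>n x. 0 \<le> \<phi> n x" "\<And>n x. \<phi> n x \<le> indicator U x"
    "\<And>x. (\<lambda>n. \<phi> n x) \<longlonglongrightarrow> indicator U x"
proof (cases "U = {}")
  case True
  show ?thesis
    by (rule that[of "\<lambda>_ _. 0"]) (auto simp: True test_function_def smooth_fun_def Ck_const)
next
  case False
  with assms obtain c r where cr: "\<And>n::nat. r n > 0" "U = (\<Union>n. ball (c n) (r n))"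
    using open_countable_Union_balls by metis
  define s where "s n x = (\<Sum>j<n. bump (c j) (r j) x)" for n x
  define \<phi> where "\<phi> n x = 1 - exp (- (real n * s n x))" for n x
  have s0: "s n x \<ge> 0" for n x
    by (simp add: s_def sum_nonneg bump_nonneg)
  have out: "s n x = 0" if "x \<notin> U" for n x
    using that cr by (auto simp: s_def intro!: sum.neutral bump_zero)
  have le: "\<phi> n x \<le> indicator U x" for n x
    using out[of x n] by (auto simp: \<phi>_def indicator_def)
  have "smooth_fun (\<lambda>x. (- real n) * s n x)" for n
    using smooth_bump unfolding smooth_fun_def s_def
    by (intro allI Ck_mult Ck_const Ck_sum) auto
  then have "smooth_fun (\<lambda>x. exp ((- real n) * s n x))" for n
    by (rule smooth_exp_compose)
  then have "smooth_fun (\<lambda>x. 1 + (- 1) * exp ((- real n) * s n x))" for n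
    unfolding smooth_fun_def by (intro allI Ck_add Ck_mult Ck_const) blast
  then have smooth: "smooth_fun (\<phi> n)" for n
    by (simp add: \<phi>_def[abs_def])
  have "{x. \<phi> n x \<noteq> 0} \<subseteq> U" for n
    using out[of _ n] by (auto simp: \<phi>_def)
  then have "compact (closure {x. \<phi> n x \<noteq> 0})" for n
    using assms(2) bounded_subset compact_closure by blast
  with smooth have test: "test_function (\<phi> n)" for n
    by (simp add: test_function_def)
  have lim: "(\<lambda>n. \<phi> n x) \<longlonglongrightarrow> indicator U x" for x
  proof (cases "x \<in> U")
    case True
    then obtain j where j: "x \<in> ball (c j) (r j)" using cr by auto
    define b where "b = bump (c j) (r j) x"
    have b: "b > 0" using j cr(1) by (simp add: b_def bump_pos_iff)
    have sb: "s n x \<ge> b" if "n > j" for n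
      unfolding s_def b_def using that
      by (intro member_le_sum) (auto simp: bump_nonneg)
    have "((\<lambda>n. exp (- (b * real n))) \<longlongrightarrow> 0) sequentially"
      using b by (intro filterlim_compose[OF exp_at_bot] filterlim_compose[OF filterlim_uminus_at_bot_at_top]
          filterlim_tendsto_pos_mult_at_top[OF tendsto_const] filterlim_real_sequentially)
    then have l: "(\<lambda>n. 1 - exp (- (b * real n))) \<longlonglongrightarrow> 1"
      by (auto intro: tendsto_eq_intros)
    have "\<forall>\<^sub>F n in sequentially. 1 - exp (- (b * real n)) \<le> \<phi> n x"
      using eventually_gt_at_top[of j]
      by eventually_elim (use sb in \<open>auto simp: \<phi>_def mult.commute mult_left_mono\<close>)
    moreover have "\<phi> n x \<le> 1" for n by (simp add: \<phi>_def)
    ultimately have "(\<lambda>n. \<phi> n x) \<longlonglongrightarrow> 1"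
      by (intro tendsto_sandwich[OF _ _ l tendsto_const]) auto
    with True show ?thesis by simp
  next
    case False
    then show ?thesis by (simp add: \<phi>_def out)
  qed
  show ?thesis
    by (rule that[of \<phi>]) (use test le lim s0 in \<open>auto simp: \<phi>_def\<close>)
qed

section \<open>Positivity tested against smooth functions\<close>

text \<open>Borel rather than Lebesgue measurability keeps maps such as
  \<open>(t, x) \<mapsto> q (x + t *\<^sub>R h)\<close> measurable for the uncompleted product
  measure, where Fubini is applied.\<close>

definition borel_loc_integrable ::
    "('a::euclidean_space \<Rightarrow> 'b::{banach, second_countable_topology}) \<Rightarrow> bool" where
  "borel_loc_integrable f \<longleftrightarrow> f \<in> borel_measurable borel \<and>
     (\<forall>r. integrable lborel (\<lambda>x. indicator (cball 0 r) x *\<^sub>R f x))"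

lemma borel_loc_integrable_measurable [measurable_dest]:
  "borel_loc_integrable f \<Longrightarrow> f \<in> borel_measurable borel"
  by (simp add: borel_loc_integrable_def)

lemma borel_loc_integrable_bound:
  assumes "borel_loc_integrable f" "h \<in> borel_measurable borel" "\<And>x. norm (h x) \<le> norm (f x)"
  shows "borel_loc_integrable h"
  unfolding borel_loc_integrable_def
proof (intro conjI allI)
  fix r
  have [measurable]: "h \<in> borel_measurable borel" by fact
  have "integrable lborel (\<lambda>x. indicator (cball 0 r) x *\<^sub>R f x)"
    using assms(1) by (simp add: borel_loc_integrable_def)
  then show "integrable lborel (\<lambda>x. indicator (cball 0 r) x *\<^sub>R h x)"
    by (rule Bochner_Integration.integrable_bound)
      (use assms(3) in \<open>auto simp: indicator_def\<close>)
qed fact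

lemma borel_loc_integrable_const: "borel_loc_integrable (\<lambda>_::'a::euclidean_space. c::real)"
  using emeasure_lborel_cball_finite[of "0::'a"]
  by (auto simp: borel_loc_integrable_def integrable_indicator_iff)

text \<open>A single hypothesis records both boundedness and bounded support of the weight;
  indicators, test functions, their derivatives and their translates all enter in this form.\<close>

lemma integrable_mult_borel_loc_integrable:
  assumes f: "borel_loc_integrable f" and w[measurable]: "w \<in> borel_measurable borel"
    and bound: "\<And>x. \<bar>w x\<bar> \<le> C * indicator (cball 0 r) x"
  shows "integrable lborel (\<lambda>x. w x *\<^sub>R f x)"
proof -
  have [measurable]: "f \<in> borel_measurable borel"
    using f by measurable
  have "integrable lborel (\<lambda>x. C *\<^sub>R (indicator (cball 0 r) x *\<^sub>R f x))"
    by (intro integrable_scaleR_right) (use f in \<open>simp add: borel_loc_integrable_def\<close>)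
  then show ?thesis
  proof (rule Bochner_Integration.integrable_bound)
    have "norm (w x *\<^sub>R f x) \<le> norm (C *\<^sub>R indicator (cball 0 r) x *\<^sub>R f x)" for x
    proof -
      have "\<bar>w x\<bar> * norm (f x) \<le> (C * indicator (cball 0 r) x) * norm (f x)"
        by (intro mult_right_mono bound) auto
      also have "\<dots> \<le> norm (C *\<^sub>R indicator (cball 0 r) x *\<^sub>R f x)"
        by (auto simp: indicator_def intro: mult_right_mono)
      finally show ?thesis by simp
    qed
    then show "AE x in lborel. norm (w x *\<^sub>R f x) \<le> norm (C *\<^sub>R indicator (cball 0 r) x *\<^sub>R f x)"
      by simp
  qed measurable
qed

lemma integral_open_nonneg_if_test_integrals_nonneg:
  fixes f :: "'a::euclidean_space \<Rightarrow> real"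
  assumes f: "borel_loc_integrable f"
    and nonneg: "\<And>\<phi>. test_function \<phi> \<Longrightarrow> (\<And>x. 0 \<le> \<phi> x) \<Longrightarrow> 0 \<le> (\<integral>x. \<phi> x * f x \<partial>lborel)"
    and U: "open U" "bounded U"
  shows "0 \<le> (\<integral>x. indicator U x * f x \<partial>lborel)"
proof -
  have [measurable]: "f \<in> borel_measurable borel"
    using f by measurable
  obtain \<phi> where \<phi>: "\<And>n. test_function (\<phi> n)" "\<And>n x. 0 \<le> \<phi> n x" "\<And>n x. \<phi> n x \<le> indicator U x"
    "\<And>x. (\<lambda>n. \<phi> n x) \<longlonglongrightarrow> indicator U x"
    using test_functions_tendsto_indicator[OF U] by metis
  have [measurable]: "\<phi> n \<in> borel_measurable borel" for n
  proof -
    have "Ck 0 (\<phi> n)"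
      using \<phi>(1)[of n] by (auto simp: test_function_def smooth_fun_def simp del: Ck.simps)
    then show ?thesis by (auto intro: borel_measurable_continuous_onI)
  qed
  have [measurable]: "U \<in> sets borel" using U by simp
  obtain r where r: "U \<subseteq> cball 0 r"
    using U(2) by (metis bounded_iff mem_cball_0 subsetI)
  have "(\<lambda>n. \<integral>x. \<phi> n x * f x \<partial>lborel) \<longlonglongrightarrow> (\<integral>x. indicator U x * f x \<partial>lborel)"
  proof (rule integral_dominated_convergence)
    show "integrable lborel (\<lambda>x. norm (indicator U x *\<^sub>R f x))"
      by (intro integrable_norm integrable_mult_borel_loc_integrable[OF f, where C = 1 and r = r])
        (use r in \<open>auto simp: indicator_def\<close>)
    show "AE x in lborel. norm (\<phi> n x * f x) \<le> norm (indicator U x *\<^sub>R f x)" for n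
      using \<phi>(2,3) by (auto simp: abs_mult intro!: mult_right_mono)
    show "AE x in lborel. (\<lambda>n. \<phi> n x * f x) \<longlonglongrightarrow> indicator U x * f x"
      by (intro AE_I2 tendsto_mult tendsto_const \<phi>(4))
  qed measurable
  moreover have "0 \<le> (\<integral>x. \<phi> n x * f x \<partial>lborel)" for n
    by (intro nonneg \<phi>)
  ultimately show ?thesis
    by (intro LIMSEQ_le_const) auto
qed

text \<open>On a ball the negative and positive parts of \<open>f\<close> define measures, and
  testing compares them on open sets. Outer regularity of the finite measure
  \<open>\<mu> pos\<close> carries the comparison to the Borel set \<open>B\<close> where
  \<open>f\<close> is negative; \<open>pos\<close> vanishes there, hence so does the mass of
  \<open>neg\<close>.\<close>

lemma AE_nonneg_if_test_integrals_nonneg: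
  fixes f :: "'a::euclidean_space \<Rightarrow> real"
  assumes f: "borel_loc_integrable f"
    and nonneg: "\<And>\<phi>. test_function \<phi> \<Longrightarrow> (\<And>x. 0 \<le> \<phi> x) \<Longrightarrow> 0 \<le> (\<integral>x. \<phi> x * f x \<partial>lborel)"
  shows "AE x in lborel. 0 \<le> f x"
proof -
  have [measurable]: "f \<in> borel_measurable borel"
    using f by measurable
  have "AE x in lborel. x \<in> ball 0 (real n) \<longrightarrow> 0 \<le> f x" for n
  proof -
    define K where "K = ball (0::'a) (real n)"
    have [measurable]: "K \<in> sets borel" by (simp add: K_def)
    define pos where "pos x = max 0 (f x)" for x
    define neg where "neg x = max 0 (- f x)" for x
    define \<mu> where "\<mu> h = density lborel (\<lambda>x. ennreal (indicator K x * h x))" for h :: "'a \<Rightarrow> real"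
    have pn: "borel_loc_integrable pos" "borel_loc_integrable neg"
      unfolding pos_def neg_def by (auto intro!: borel_loc_integrable_bound[OF f])
    have [measurable]: "pos \<in> borel_measurable borel" "neg \<in> borel_measurable borel"
      using pn by measurable
    have \<mu>_eq: "emeasure (\<mu> h) V = ennreal (\<integral>x. indicator (K \<inter> V) x * h x \<partial>lborel)"
      if h: "h = pos \<or> h = neg" and V[measurable]: "V \<in> sets borel" for h V
    proof -
      have [measurable]: "h \<in> borel_measurable borel" and int: "borel_loc_integrable h"
        and h0: "\<And>x. 0 \<le> h x"
        using h pn by (auto simp: pos_def neg_def)
      have "emeasure (\<mu> h) V = (\<integral>\<^sup>+x. ennreal (indicator (K \<inter> V) x *\<^sub>R h x) \<partial>lborel)"
        by (simp add: \<mu>_def emeasure_density) (auto intro!: nn_integral_cong simp: indicator_def)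
      also have "\<dots> = ennreal (\<integral>x. indicator (K \<inter> V) x *\<^sub>R h x \<partial>lborel)"
        by (intro nn_integral_eq_integral integrable_mult_borel_loc_integrable[OF int, where C = 1 and r = n])
          (auto simp: K_def indicator_def h0)
      finally show ?thesis by simp
    qed
    have open_le: "emeasure (\<mu> neg) V \<le> emeasure (\<mu> pos) V" if V: "open V" for V
    proof -
      have [measurable]: "V \<in> sets borel" using V by simp
      have "0 \<le> (\<integral>x. indicator (K \<inter> V) x * f x \<partial>lborel)"
        by (intro integral_open_nonneg_if_test_integrals_nonneg[OF f nonneg]) (use V in \<open>auto simp: K_def\<close>)
      also have "\<dots> = (\<integral>x. indicator (K \<inter> V) x *\<^sub>R pos x - indicator (K \<inter> V) x *\<^sub>R neg x \<partial>lborel)"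
        by (intro Bochner_Integration.integral_cong) (auto simp: pos_def neg_def indicator_def)
      also have "\<dots> = (\<integral>x. indicator (K \<inter> V) x *\<^sub>R pos x \<partial>lborel) - (\<integral>x. indicator (K \<inter> V) x *\<^sub>R neg x \<partial>lborel)"
        by (intro Bochner_Integration.integral_diff
            integrable_mult_borel_loc_integrable[OF pn(1), where C = 1 and r = n]
            integrable_mult_borel_loc_integrable[OF pn(2), where C = 1 and r = n])
          (auto simp: K_def indicator_def)
      finally show ?thesis
        by (simp add: \<mu>_eq V ennreal_leI)
    qed
    define B where "B = {x. f x < 0}"
    have B[measurable]: "B \<in> sets borel" unfolding B_def by measurable
    have "emeasure (\<mu> neg) B \<le> (INF V\<in>{V. B \<subseteq> V \<and> open V}. emeasure (\<mu> pos) V)"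
      by (intro INF_greatest order_trans[OF emeasure_mono open_le]) (auto simp: \<mu>_def)
    also have "\<dots> = emeasure (\<mu> pos) B"
    proof (rule outer_regular[symmetric])
      have "space (\<mu> pos) = UNIV" by (simp add: \<mu>_def)
      then show "emeasure (\<mu> pos) (space (\<mu> pos)) \<noteq> \<infinity>" by (simp add: \<mu>_eq)
    qed (auto simp: \<mu>_def)
    also have "\<dots> = 0"
      by (subst \<mu>_eq) (auto simp: B_def pos_def indicator_def intro!: integral_eq_zero_AE)
    finally have "emeasure (\<mu> neg) B = 0" by simp
    then have "AE x in lborel. ennreal (indicator K x * neg x) * indicator B x = 0"
      by (simp add: \<mu>_def emeasure_density nn_integral_0_iff_AE)
    then show ?thesis
      by eventually_elim (auto simp: B_def neg_def K_def indicator_def split: if_splits)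
  qed
  then have "AE x in lborel. \<forall>n. x \<in> ball 0 (real n) \<longrightarrow> 0 \<le> f x"
    by (subst AE_all_countable) blast
  then show ?thesis
  proof eventually_elim
    case (elim x)
    obtain n where "norm x < real n" using reals_Archimedean2 by blast
    with elim show ?case by auto
  qed
qed

section \<open>Averages over segments\<close>

lemma nn_integral_translate:
  fixes f :: "'a::euclidean_space \<Rightarrow> ennreal"
  assumes [measurable]: "f \<in> borel_measurable borel"
  shows "(\<integral>\<^sup>+x. f (x + a) \<partial>lborel) = (\<integral>\<^sup>+x. f x \<partial>lborel)"
proof -
  have "(\<integral>\<^sup>+x. f x \<partial>lborel) = (\<integral>\<^sup>+x. f x \<partial>distr lborel borel ((+) a))"
    by (simp add: lborel_distr_plus)
  also have "\<dots> = (\<integral>\<^sup>+x. f (a + x) \<partial>lborel)"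
    by (intro nn_integral_distr) auto
  finally show ?thesis by (simp add: add.commute)
qed

lemma integral_translate:
  fixes f :: "'a::euclidean_space \<Rightarrow> 'b::{banach, second_countable_topology}"
  assumes [measurable]: "f \<in> borel_measurable borel"
  shows "(\<integral>x. f (x + a) \<partial>lborel) = (\<integral>x. f x \<partial>lborel)"
proof -
  have "(\<integral>x. f x \<partial>lborel) = (\<integral>x. f x \<partial>distr lborel borel ((+) a))"
    by (simp add: lborel_distr_plus)
  also have "\<dots> = (\<integral>x. f (a + x) \<partial>lborel)"
    by (intro integral_distr) auto
  finally show ?thesis by (simp add: add.commute)
qed

lemma integrable_translate:
  fixes f :: "'a::euclidean_space \<Rightarrow> 'b::{banach, second_countable_topology}"
  assumes "integrable lborel f"
  shows "integrable lborel (\<lambda>x. f (x + a))"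
proof -
  have [measurable]: "f \<in> borel_measurable borel" using assms by auto
  have "integrable (distr lborel borel ((+) a)) f"
    using assms by (simp add: lborel_distr_plus)
  then show ?thesis
    by (subst (asm) integrable_distr_eq) (auto simp: add.commute)
qed

lemma AE_translate:
  fixes P :: "'a::euclidean_space \<Rightarrow> bool"
  assumes "AE x in lborel. P x" and [measurable]: "Measurable.pred borel P"
  shows "AE x in lborel. P (x + a)"
proof -
  have "AE x in distr lborel borel ((+) a). P x"
    using assms(1) by (subst lborel_distr_plus)
  then show ?thesis
    by (subst (asm) AE_distr_iff) (auto simp: add.commute)
qed

definition segment_average :: "'a::euclidean_space \<Rightarrow> ('a \<Rightarrow> real) \<Rightarrow> 'a \<Rightarrow> real" where
  "segment_average h q x = (\<integral>t. indicator {0..1} t * q (x + t *\<^sub>R h) \<partial>lborel)"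

text \<open>One ball of radius \<open>r + norm h\<close> serves all \<open>t\<close> in the unit
  interval. The absolute value of \<open>C\<close> is taken because \<open>C\<close> may be negative
  when \<open>cball 0 r\<close> is empty.\<close>

lemma translate_bound:
  fixes w :: "'a::euclidean_space \<Rightarrow> real"
  assumes bound: "\<And>x. \<bar>w x\<bar> \<le> C * indicator (cball 0 r) x" and "t \<in> {0..1}"
  shows "\<bar>w (x - t *\<^sub>R h)\<bar> \<le> \<bar>C\<bar> * indicator (cball 0 (r + norm h)) x"
proof (cases "x - t *\<^sub>R h \<in> cball 0 r")
  case True
  have "norm x \<le> norm (x - t *\<^sub>R h) + norm (t *\<^sub>R h)"
    by (metis diff_add_cancel norm_triangle_ineq)
  also have "\<dots> \<le> r + norm h"
    using True assms by (intro add_mono) (auto intro: mult_left_le_one_le)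
  finally show ?thesis
    using bound[of "x - t *\<^sub>R h"] True by simp
qed (use bound[of "x - t *\<^sub>R h"] in \<open>auto simp: indicator_def\<close>)

context
  fixes q w :: "'a::euclidean_space \<Rightarrow> real" and C r :: real
  assumes q: "borel_loc_integrable q" and w: "w \<in> borel_measurable borel"
    and bound: "\<And>x. \<bar>w x\<bar> \<le> C * indicator (cball 0 r) x"
begin

text \<open>Translation moves the shift from \<open>q\<close> to \<open>w\<close>; by
  \<open>translate_bound\<close> the norms of the slices are then at most \<open>D\<close>,
  uniformly in \<open>t\<close>, as Fubini requires.\<close>

lemma integrable_shifted_product:
  "integrable (lborel \<Otimes>\<^sub>M lborel) (\<lambda>(t, x). indicator {0..1} t * (w x * q (x + t *\<^sub>R h)))"
proof -
  have [measurable]: "q \<in> borel_measurable borel" "w \<in> borel_measurable borel"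
    using q w by measurable
  define D where "D = (\<integral>x. (\<bar>C\<bar> * indicator (cball 0 (r + norm h)) x) *\<^sub>R \<bar>q x\<bar> \<partial>lborel)"
  have qn: "borel_loc_integrable (\<lambda>x. \<bar>q x\<bar>)"
    by (rule borel_loc_integrable_bound[OF q]) auto
  have int: "integrable lborel (\<lambda>x. w x * q (x + t *\<^sub>R h))"
    and le: "(\<integral>x. \<bar>w x * q (x + t *\<^sub>R h)\<bar> \<partial>lborel) \<le> D" if t: "t \<in> {0..1}" for t
  proof -
    have i: "integrable lborel (\<lambda>x. w (x - t *\<^sub>R h) *\<^sub>R q x)"
      by (rule integrable_mult_borel_loc_integrable[OF q _ translate_bound[OF bound t]]) measurable
    from integrable_translate[OF this, of "t *\<^sub>R h"]
    show "integrable lborel (\<lambda>x. w x * q (x + t *\<^sub>R h))" by simp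
    have "(\<integral>x. \<bar>w x * q (x + t *\<^sub>R h)\<bar> \<partial>lborel) = (\<integral>x. \<bar>w (x - t *\<^sub>R h) *\<^sub>R q x\<bar> \<partial>lborel)"
      using integral_translate[of "\<lambda>x. \<bar>w (x - t *\<^sub>R h) *\<^sub>R q x\<bar>" "t *\<^sub>R h"] by simp
    also have "\<dots> \<le> D"
      unfolding D_def
    proof (intro integral_mono integrable_abs i)
      show "integrable lborel (\<lambda>x. (\<bar>C\<bar> * indicator (cball 0 (r + norm h)) x) *\<^sub>R \<bar>q x\<bar>)"
        by (intro integrable_mult_borel_loc_integrable[OF qn, where C = "\<bar>C\<bar>" and r = "r + norm h"])
          (auto simp: indicator_def)
      show "\<bar>w (x - t *\<^sub>R h) *\<^sub>R q x\<bar> \<le> (\<bar>C\<bar> * indicator (cball 0 (r + norm h)) x) *\<^sub>R \<bar>q x\<bar>" for x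
        using mult_right_mono[OF translate_bound[OF bound t, of x h], of "\<bar>q x\<bar>"] by (simp add: abs_mult)
    qed
    finally show "(\<integral>x. \<bar>w x * q (x + t *\<^sub>R h)\<bar> \<partial>lborel) \<le> D" .
  qed
  show ?thesis
  proof (rule lborel_pair.Fubini_integrable)
    show "AE t in lborel. integrable lborel
        (\<lambda>x. case (t, x) of (t, x) \<Rightarrow> indicator {0..1} t * (w x * q (x + t *\<^sub>R h)))"
      using int by (auto simp: indicator_def)
    have "integrable lborel (\<lambda>t::real. indicator {0..1} t *\<^sub>R D)"
      by simp
    then show "integrable lborel (\<lambda>t. \<integral>x. norm
        (case (t, x) of (t, x) \<Rightarrow> indicator {0..1} t * (w x * q (x + t *\<^sub>R h))) \<partial>lborel)"
    proof (rule Bochner_Integration.integrable_bound)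
      show "AE t in lborel. norm (\<integral>x. norm
          (case (t, x) of (t, x) \<Rightarrow> indicator {0..1} t * (w x * q (x + t *\<^sub>R h))) \<partial>lborel)
          \<le> norm (indicator {0..1} t *\<^sub>R D)"
        using le by (auto simp: indicator_def intro: order_trans[OF _ abs_ge_self])
    qed measurable
  qed measurable
qed

text \<open>Fubini and a translation put the whole dependence on the shift into the weight and leave
  \<open>q\<close> fixed. This is what makes later bounds uniform in the shift and lets limits be
  taken in a continuous weight instead of in \<open>q\<close>.\<close>

lemma
  shows integrable_mult_segment_average: "integrable lborel (\<lambda>x. w x * segment_average h q x)"
    and integral_mult_segment_average: "(\<integral>x. w x * segment_average h q x \<partial>lborel) =
      (\<integral>t. indicator {0..1} t * (\<integral>x. w (x - t *\<^sub>R h) * q x \<partial>lborel) \<partial>lborel)"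
    and AE_integrable_segment: "AE x in lborel. integrable lborel
      (\<lambda>t. w x * (indicator {0..1} t * q (x + t *\<^sub>R h)))"
proof -
  have [measurable]: "q \<in> borel_measurable borel" "w \<in> borel_measurable borel"
    using q w by measurable
  note int = integrable_shifted_product[of h]
  have eq: "w x * segment_average h q x = (\<integral>t. indicator {0..1} t * (w x * q (x + t *\<^sub>R h)) \<partial>lborel)" for x
    unfolding segment_average_def by (subst integral_mult_right_zero[symmetric]) (simp add: mult_ac)
  show "integrable lborel (\<lambda>x. w x * segment_average h q x)"
    unfolding eq using lborel_pair.integrable_snd[OF int] by simp
  show "AE x in lborel. integrable lborel (\<lambda>t. w x * (indicator {0..1} t * q (x + t *\<^sub>R h)))"
    using lborel_pair.AE_integrable_snd[OF int] by (simp add: mult_ac)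
  have "(\<integral>x. w x * segment_average h q x \<partial>lborel) =
      (\<integral>t. (\<integral>x. indicator {0..1} t * (w x * q (x + t *\<^sub>R h)) \<partial>lborel) \<partial>lborel)"
    unfolding eq using lborel_pair.Fubini_integral[OF int] by simp
  also have "\<dots> = (\<integral>t. indicator {0..1} t * (\<integral>x. w (x - t *\<^sub>R h) * q x \<partial>lborel) \<partial>lborel)"
  proof (intro Bochner_Integration.integral_cong refl)
    fix t :: real
    show "(\<integral>x. indicator {0..1} t * (w x * q (x + t *\<^sub>R h)) \<partial>lborel) =
        indicator {0..1} t * (\<integral>x. w (x - t *\<^sub>R h) * q x \<partial>lborel)"
      using integral_translate[of "\<lambda>x. w (x - t *\<^sub>R h) * q x" "t *\<^sub>R h"] by simp
  qed
  finally show "(\<integral>x. w x * segment_average h q x \<partial>lborel) =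
      (\<integral>t. indicator {0..1} t * (\<integral>x. w (x - t *\<^sub>R h) * q x \<partial>lborel) \<partial>lborel)" .
qed

end

lemma borel_loc_integrable_segment_average:
  fixes q :: "'a::euclidean_space \<Rightarrow> real"
  assumes q: "borel_loc_integrable q"
  shows "borel_loc_integrable (segment_average h q)"
  unfolding borel_loc_integrable_def
proof (intro conjI allI)
  have [measurable]: "q \<in> borel_measurable borel" using q by measurable
  show "segment_average h q \<in> borel_measurable borel"
    unfolding segment_average_def[abs_def] by measurable
  show "integrable lborel (\<lambda>x. indicator (cball 0 r) x *\<^sub>R segment_average h q x)" for r
    using integrable_mult_segment_average[OF q, of "indicator (cball 0 r)" 1 r h]
    by (simp add: borel_measurable_indicator)
qed

text \<open>Where the slice is not integrable, \<open>segment_average\<close> is 0 by convention and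
  bounds nothing from above; this excludes that case for almost every \<open>x\<close>.\<close>

lemma AE_integrable_on_segment:
  fixes q :: "'a::euclidean_space \<Rightarrow> real"
  assumes q: "borel_loc_integrable q"
  shows "AE x in lborel. integrable lborel (\<lambda>t. indicator {0..1} t * q (x + t *\<^sub>R h))"
proof -
  have "AE x in lborel. \<forall>n::nat. integrable lborel
      (\<lambda>t. indicator (cball 0 (real n)) x * (indicator {0..1} t * q (x + t *\<^sub>R h)))"
    by (subst AE_all_countable, intro allI AE_integrable_segment[OF q, where C = 1])
      (auto intro!: borel_measurable_indicator)
  then show ?thesis
  proof eventually_elim
    case (elim x)
    obtain n where "norm x \<le> real n" using real_arch_simple by blast
    with elim[rule_format, of n] show ?case by simp
  qed
qed

section \<open>Differences as averages of the weak gradient\<close>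

lemma integrable_unit_interval_times:
  fixes G :: "'a::euclidean_space \<Rightarrow> real"
  assumes G: "integrable lborel G"
  shows "integrable (lborel \<Otimes>\<^sub>M lborel) (\<lambda>(t::real, x). indicator {0..1} t * G x)"
proof (rule lborel_pair.Fubini_integrable)
  have [measurable]: "G \<in> borel_measurable borel" using G by auto
  show "(\<lambda>(t::real, x). indicator {0..1} t * G x) \<in> borel_measurable (lborel \<Otimes>\<^sub>M lborel)"
    by measurable
  show "integrable lborel (\<lambda>t::real. \<integral>x. norm (case (t, x) of (t, x) \<Rightarrow> indicator {0..1} t * G x) \<partial>lborel)"
    by (simp add: abs_mult)
  show "AE t in lborel. integrable lborel (\<lambda>x. case (t::real, x) of (t, x) \<Rightarrow> indicator {0..1} t * G x)"
    using G by simp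
qed

lemma borel_loc_integrable_diff:
  "borel_loc_integrable f \<Longrightarrow> borel_loc_integrable g \<Longrightarrow> borel_loc_integrable (\<lambda>x. f x - g x)"
  by (auto simp: borel_loc_integrable_def scaleR_diff_right)

lemma borel_loc_integrable_inner:
  fixes g :: "'a::euclidean_space \<Rightarrow> 'a"
  assumes g: "borel_loc_integrable g"
  shows "borel_loc_integrable (\<lambda>x. g x \<bullet> v)"
  unfolding borel_loc_integrable_def
proof (intro conjI allI)
  have [measurable]: "g \<in> borel_measurable borel" using g by measurable
  show "(\<lambda>x. g x \<bullet> v) \<in> borel_measurable borel" by measurable
  fix r
  have "integrable lborel (\<lambda>x. (indicator (cball 0 r) x *\<^sub>R g x) \<bullet> v)"
    by (intro integrable_inner_left) (use g in \<open>simp add: borel_loc_integrable_def\<close>)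
  then show "integrable lborel (\<lambda>x. indicator (cball 0 r) x *\<^sub>R (g x \<bullet> v))"
    by simp
qed

lemma borel_loc_integrable_translate:
  assumes f: "borel_loc_integrable f"
  shows "borel_loc_integrable (\<lambda>x. f (x + h))"
  unfolding borel_loc_integrable_def
proof (intro conjI allI)
  have [measurable]: "f \<in> borel_measurable borel" using f by measurable
  show "(\<lambda>x. f (x + h)) \<in> borel_measurable borel" by measurable
  fix r
  have "norm x \<le> r + norm h" if "norm (x - h) \<le> r" for x
    using that norm_triangle_sub[of x h] by linarith
  then have "integrable lborel (\<lambda>x. indicator (cball 0 r) (x - h) *\<^sub>R f x)"
    by (intro integrable_mult_borel_loc_integrable[OF f, where C = 1 and r = "r + norm h"])
      (auto simp: indicator_def)
  from integrable_translate[OF this, of h]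
  show "integrable lborel (\<lambda>x. indicator (cball 0 r) x *\<^sub>R f (x + h))" by simp
qed

section \<open>Bounds for test functions and their derivatives\<close>

lemma continuous_bound:
  fixes f :: "'a::euclidean_space \<Rightarrow> real"
  assumes cont: "continuous_on UNIV f" and zero: "\<And>x. x \<notin> cball 0 r \<Longrightarrow> f x = 0"
  obtains C where "\<And>x. \<bar>f x\<bar> \<le> C * indicator (cball 0 r) x"
proof -
  have "compact (f ` cball 0 r)"
    using cont by (intro compact_continuous_image) (auto intro: continuous_on_subset)
  then obtain C where "\<And>x. x \<in> cball 0 r \<Longrightarrow> \<bar>f x\<bar> \<le> C"
    using compact_imp_bounded by (fastforce simp: bounded_iff)
  with zero show ?thesis
    by (intro that[of C]) (auto simp: indicator_def)
qed

lemma test_function_Ck: "test_function \<phi> \<Longrightarrow> Ck k \<phi>"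
  by (simp add: test_function_def smooth_fun_def)

lemma test_function_continuous: "test_function \<phi> \<Longrightarrow> continuous_on UNIV \<phi>"
  using test_function_Ck[of \<phi> 0] by simp

lemma test_function_derivative:
  assumes "test_function \<phi>"
  shows "(\<phi> has_derivative frechet_derivative \<phi> (at x)) (at x)"
  using assms by (intro Ck_has_derivative[of 0] test_function_Ck)

lemma test_function_support:
  assumes \<phi>: "test_function \<phi>"
  obtains r where "\<And>x. x \<notin> cball 0 r \<Longrightarrow> \<phi> x = 0"
    "\<And>x. x \<notin> cball 0 r \<Longrightarrow> frechet_derivative \<phi> (at x) = (\<lambda>_. 0)"
proof -
  \<comment> \<open>The closure matters: its complement is open, so \<open>\<phi>\<close> vanishes
    near each point outside \<open>S\<close> and its derivative vanishes there as well.\<close>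
  define S where "S = closure {x. \<phi> x \<noteq> 0}"
  have "bounded S"
    using \<phi> by (simp add: S_def test_function_def compact_imp_bounded)
  then obtain r where r: "\<And>x. x \<in> S \<Longrightarrow> norm x \<le> r"
    by (auto simp: bounded_iff)
  have z: "\<phi> x = 0" if "x \<notin> S" for x
    using that closure_subset[of "{x. \<phi> x \<noteq> 0}"] by (auto simp: S_def)
  have "frechet_derivative \<phi> (at x) = (\<lambda>_. 0)" if "x \<notin> S" for x
  proof -
    have "((\<lambda>_. 0) has_derivative (\<lambda>_. 0)) (at x)" by simp
    moreover have "open (- S)" by (simp add: S_def open_Compl)
    moreover have "x \<in> - S" using that by simp
    moreover have "0 = \<phi> y" if "y \<in> - S" for y using z[of y] that by simp
    ultimately have "(\<phi> has_derivative (\<lambda>_. 0)) (at x)"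
      by (rule has_derivative_transform_within_open)
    then show ?thesis using frechet_derivative_at by fastforce
  qed
  with r z show ?thesis by (intro that[of r]) auto
qed

lemma test_function_bound:
  assumes "test_function \<phi>"
  shows "\<exists>C r. \<forall>x. \<bar>\<phi> x\<bar> \<le> C * indicator (cball 0 r) x"
  using test_function_support[OF assms] continuous_bound[OF test_function_continuous[OF assms]]
  by metis

lemma frechet_derivative_basis_sum:
  fixes f :: "'a::euclidean_space \<Rightarrow> real"
  assumes "(f has_derivative f') (at x)"
  shows "f' h = (\<Sum>i\<in>Basis. (h \<bullet> i) * f' i)"
proof -
  note lin = has_derivative_linear[OF assms]
  have "f' h = f' (\<Sum>i\<in>Basis. (h \<bullet> i) *\<^sub>R i)"
    by (simp add: euclidean_representation)
  also have "\<dots> = (\<Sum>i\<in>Basis. (h \<bullet> i) * f' i)"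
    by (simp add: linear_sum[OF lin] linear_cmul[OF lin])
  finally show ?thesis .
qed

lemma test_function_directional_derivative:
  assumes \<phi>: "test_function \<phi>"
  shows "continuous_on UNIV (\<lambda>x. frechet_derivative \<phi> (at x) h)"
    and "\<exists>C r. \<forall>x. \<bar>frechet_derivative \<phi> (at x) h\<bar> \<le> C * indicator (cball 0 r) x"
proof -
  have "continuous_on UNIV (\<lambda>x. frechet_derivative \<phi> (at x) i)" if "i \<in> Basis" for i
    using test_function_Ck[OF \<phi>, of "Suc 0"] that by simp
  then show c: "continuous_on UNIV (\<lambda>x. frechet_derivative \<phi> (at x) h)"
    by (subst frechet_derivative_basis_sum[OF test_function_derivative[OF \<phi>]])
      (intro continuous_intros)
  obtain r where "\<And>x. x \<notin> cball 0 r \<Longrightarrow> frechet_derivative \<phi> (at x) h = 0"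
    using test_function_support[OF \<phi>] by metis
  from continuous_bound[OF c this]
  show "\<exists>C r. \<forall>x. \<bar>frechet_derivative \<phi> (at x) h\<bar> \<le> C * indicator (cball 0 r) x"
    by metis
qed

lemma frechet_derivative_translate:
  fixes \<phi> :: "'a::euclidean_space \<Rightarrow> real"
  assumes "test_function \<phi>"
  shows "frechet_derivative (\<lambda>x. \<phi> (x + v)) (at x) = frechet_derivative \<phi> (at (x + v))"
proof -
  have "((\<lambda>x. \<phi> (x + v)) has_derivative frechet_derivative \<phi> (at (x + v))) (at x)"
    by (rule has_derivative_compose[OF _ test_function_derivative[OF assms], of "\<lambda>x. x + v" "\<lambda>x. x"])
      (auto intro!: derivative_eq_intros)
  then show ?thesis using frechet_derivative_at by metis
qed

lemma test_function_translate:
  fixes \<phi> :: "'a::euclidean_space \<Rightarrow> real"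
  assumes "test_function \<phi>"
  shows "test_function (\<lambda>x. \<phi> (x + v))"
proof -
  have "{x. \<phi> (x + v) \<noteq> 0} = (+) (- v) ` {x. \<phi> x \<noteq> 0}"
    by (force simp: image_iff algebra_simps intro: exI[of _ "_ + v"])
  then have "closure {x. \<phi> (x + v) \<noteq> 0} = (+) (- v) ` closure {x. \<phi> x \<noteq> 0}"
    by (simp only: closure_translation)
  moreover have "compact ((+) (- v) ` closure {x. \<phi> x \<noteq> 0})"
    using assms by (intro compact_translation) (simp add: test_function_def)
  ultimately have "compact (closure {x. \<phi> (x + v) \<noteq> 0})"
    by simp
  with assms show ?thesis
    by (simp add: test_function_def smooth_fun_def Ck_translate)
qed

lemma test_function_difference:
  fixes \<phi> :: "'a::euclidean_space \<Rightarrow> real"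
  assumes \<phi>: "test_function \<phi>"
  shows "(\<integral>t. indicator {0..1} t * frechet_derivative \<phi> (at (x - t *\<^sub>R h)) h \<partial>lborel) = \<phi> x - \<phi> (x - h)"
proof -
  let ?f = "\<lambda>t. frechet_derivative \<phi> (at (x - t *\<^sub>R h)) h"
  \<comment> \<open>The path runs backwards along \<open>h\<close>, so the antiderivative in
    \<open>t\<close> is \<open>- \<phi> (x - t *\<^sub>R h)\<close>.\<close>
  have "(\<integral>t. indicator {0..1} t *\<^sub>R ?f t \<partial>lborel) = - \<phi> (x - 1 *\<^sub>R h) - - \<phi> (x - 0 *\<^sub>R h)"
  proof (rule integral_FTC_Icc)
    fix t :: real
    have "((\<lambda>t. - \<phi> (x - t *\<^sub>R h)) has_derivative
        (\<lambda>s. - frechet_derivative \<phi> (at (x - t *\<^sub>R h)) (- s *\<^sub>R h))) (at t)"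
      by (intro has_derivative_minus has_derivative_compose[OF _ test_function_derivative[OF \<phi>]])
        (auto intro!: derivative_eq_intros)
    then have "((\<lambda>t. - \<phi> (x - t *\<^sub>R h)) has_derivative (\<lambda>s. s *\<^sub>R ?f t)) (at t)"
      using has_derivative_linear[OF test_function_derivative[OF \<phi>, of "x - t *\<^sub>R h"]]
      by (simp add: linear_cmul linear_neg)
    then show "((\<lambda>t. - \<phi> (x - t *\<^sub>R h)) has_vector_derivative ?f t) (at t within {0..1})"
      by (simp add: has_vector_derivative_def has_derivative_at_withinI)
  next
    show "continuous_on {0..1} ?f"
      by (rule continuous_on_compose2[OF test_function_directional_derivative(1)[OF \<phi>]])
        (auto intro!: continuous_intros)
  qed simp
  then show ?thesis by simp
qed

section \<open>Integration by parts for finite differences\<close>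

text \<open>Separates the analysis from questions of completion: the theorem instantiates this with
  Borel representatives of \<open>u\<close> and \<open>g\<close>.\<close>

locale borel_weak_gradient =
  fixes u :: "'a::euclidean_space \<Rightarrow> real" and g :: "'a \<Rightarrow> 'a"
  assumes u: "borel_loc_integrable u" and g: "borel_loc_integrable g"
    and weak: "\<And>\<phi> i. test_function \<phi> \<Longrightarrow> i \<in> Basis \<Longrightarrow>
      (\<integral>x. u x * frechet_derivative \<phi> (at x) i \<partial>lborel) = - (\<integral>x. (g x \<bullet> i) * \<phi> x \<partial>lborel)"
begin

lemma u_measurable [measurable]: "u \<in> borel_measurable borel"
  using u by measurable

lemma g_measurable [measurable]: "g \<in> borel_measurable borel"
  using g by measurable

lemma integrable_u_mult:
  "continuous_on UNIV w \<Longrightarrow> (\<And>x. \<bar>w x\<bar> \<le> C * indicator (cball 0 r) x) \<Longrightarrow> integrable lborel (\<lambda>x. u x * w x)"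
  using integrable_mult_borel_loc_integrable[OF u borel_measurable_continuous_onI, of w C r]
  by (simp add: mult.commute)

lemma weak_directional:
  assumes \<phi>: "test_function \<phi>"
  shows "(\<integral>x. u x * frechet_derivative \<phi> (at x) h \<partial>lborel) = - (\<integral>x. \<phi> x * (g x \<bullet> h) \<partial>lborel)"
proof -
  have i1: "integrable lborel (\<lambda>x. u x * frechet_derivative \<phi> (at x) i)" for i
    using test_function_directional_derivative[OF \<phi>] integrable_u_mult by blast
  obtain C r where C: "\<And>x. \<bar>\<phi> x\<bar> \<le> C * indicator (cball 0 r) x"
    using test_function_bound[OF \<phi>] by blast
  have i2: "integrable lborel (\<lambda>x. (g x \<bullet> i) * \<phi> x)" for i
    using integrable_mult_borel_loc_integrable[OF borel_loc_integrable_inner[OF g, of i]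
        borel_measurable_continuous_onI[OF test_function_continuous[OF \<phi>]] C]
    by (simp add: mult.commute)
  have "(\<integral>x. u x * frechet_derivative \<phi> (at x) h \<partial>lborel) =
      (\<integral>x. (\<Sum>i\<in>Basis. (h \<bullet> i) * (u x * frechet_derivative \<phi> (at x) i)) \<partial>lborel)"
    by (subst frechet_derivative_basis_sum[OF test_function_derivative[OF \<phi>]])
      (simp add: sum_distrib_left mult_ac)
  also have "\<dots> = (\<Sum>i\<in>Basis. (h \<bullet> i) * - (\<integral>x. (g x \<bullet> i) * \<phi> x \<partial>lborel))"
    using i1 weak[OF \<phi>] by (subst Bochner_Integration.integral_sum) auto
  also have "\<dots> = - (\<integral>x. (\<Sum>i\<in>Basis. (h \<bullet> i) * ((g x \<bullet> i) * \<phi> x)) \<partial>lborel)"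
    using i2 by (subst Bochner_Integration.integral_sum) (auto simp: sum_negf)
  also have "(\<lambda>x. \<Sum>i\<in>Basis. (h \<bullet> i) * ((g x \<bullet> i) * \<phi> x)) = (\<lambda>x. \<phi> x * (g x \<bullet> h))"
    by (subst euclidean_inner[of _ h]) (simp add: sum_distrib_left mult_ac)
  finally show ?thesis .
qed

text \<open>The difference is moved from \<open>u\<close> to \<open>\<phi>\<close>, where the
  fundamental theorem of calculus is available. After Fubini the definition of the weak gradient is
  applied for each \<open>t\<close> to the translate \<open>\<phi> (x - t *\<^sub>R h)\<close>, and
  \<open>integral_mult_segment_average\<close> moves the shift back to the gradient.\<close>

lemma test_integral_difference:
  assumes \<phi>: "test_function \<phi>"
  shows "(\<integral>x. \<phi> x * (u (x + h) - u x) \<partial>lborel) =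
    (\<integral>x. \<phi> x * segment_average h (\<lambda>x. g x \<bullet> h) x \<partial>lborel)"
proof -
  let ?D = "\<lambda>x. frechet_derivative \<phi> (at x) h"
  have cont: "continuous_on UNIV \<phi>" by (rule test_function_continuous[OF \<phi>])
  have [measurable]: "\<phi> \<in> borel_measurable borel"
    by (rule borel_measurable_continuous_onI[OF cont])
  have [measurable]: "?D \<in> borel_measurable borel"
    by (rule borel_measurable_continuous_onI[OF test_function_directional_derivative(1)[OF \<phi>]])
  obtain C r where C: "\<And>x. \<bar>\<phi> x\<bar> \<le> C * indicator (cball 0 r) x"
    using test_function_bound[OF \<phi>] by blast
  obtain C' r' where C': "\<And>x. \<bar>?D x\<bar> \<le> C' * indicator (cball 0 r') x"
    using test_function_directional_derivative(2)[OF \<phi>] by blast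
  have \<phi>_u: "integrable lborel (\<lambda>x. \<phi> x * u x)"
    using integrable_u_mult[OF cont C] by (simp add: mult.commute)
  have \<phi>_uh: "integrable lborel (\<lambda>x. \<phi> x * u (x + h))"
    using integrable_mult_borel_loc_integrable[OF borel_loc_integrable_translate[OF u] _ C] by simp
  from integrable_translate[OF this, of "- h"]
  have \<phi>h_u: "integrable lborel (\<lambda>x. \<phi> (x - h) * u x)" by simp
  \<comment> \<open>By \<open>translate_bound\<close>, \<open>G\<close> dominates the integrand for
    all \<open>t\<close> in the unit interval simultaneously.\<close>
  define G where "G x = (\<bar>C'\<bar> * indicator (cball 0 (r' + norm h)) x) *\<^sub>R \<bar>u x\<bar>" for x
  have "borel_loc_integrable (\<lambda>x. \<bar>u x\<bar>)"
    by (rule borel_loc_integrable_bound[OF u]) auto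
  then have "integrable lborel G"
    unfolding G_def
    by (rule integrable_mult_borel_loc_integrable[where C = "\<bar>C'\<bar>" and r = "r' + norm h"])
      (auto simp: indicator_def)
  then have "integrable (lborel \<Otimes>\<^sub>M lborel) (\<lambda>(t::real, x). indicator {0..1} t * G x)"
    by (rule integrable_unit_interval_times)
  then have int: "integrable (lborel \<Otimes>\<^sub>M lborel)
      (\<lambda>(t, x). indicator {0..1} t * (u x * ?D (x - t *\<^sub>R h)))"
  proof (rule Bochner_Integration.integrable_bound)
    have "\<bar>indicator {0..1} t * (u x * ?D (x - t *\<^sub>R h))\<bar> \<le> \<bar>indicator {0..1} t * G x\<bar>" for t x
      using mult_right_mono[OF translate_bound[OF C', of t x h], of "\<bar>u x\<bar>"]
      by (auto simp: indicator_def G_def abs_mult mult.commute)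
    then show "AE p in lborel \<Otimes>\<^sub>M lborel.
        norm (case p of (t, x) \<Rightarrow> indicator {0..1} t * (u x * ?D (x - t *\<^sub>R h)))
        \<le> norm (case p of (t, x) \<Rightarrow> indicator {0..1} t * G x)"
      by (intro AE_I2) auto
  qed measurable
  have "(\<integral>x. \<phi> x * (u (x + h) - u x) \<partial>lborel) =
      (\<integral>x. \<phi> x * u (x + h) \<partial>lborel) - (\<integral>x. \<phi> x * u x \<partial>lborel)"
    using \<phi>_u \<phi>_uh by (simp add: right_diff_distrib)
  also have "(\<integral>x. \<phi> x * u (x + h) \<partial>lborel) = (\<integral>x. \<phi> (x - h) * u x \<partial>lborel)"
    using integral_translate[of "\<lambda>x. \<phi> (x - h) * u x" h] by simp
  also have "(\<integral>x. \<phi> (x - h) * u x \<partial>lborel) - (\<integral>x. \<phi> x * u x \<partial>lborel) =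
      (\<integral>x. - (u x * (\<phi> x - \<phi> (x - h))) \<partial>lborel)"
    using \<phi>_u \<phi>h_u by (subst Bochner_Integration.integral_diff[symmetric]) (auto simp: algebra_simps)
  also have "\<dots> = - (\<integral>x. (\<integral>t. indicator {0..1} t * (u x * ?D (x - t *\<^sub>R h)) \<partial>lborel) \<partial>lborel)"
    unfolding test_function_difference[OF \<phi>, symmetric]
    by (simp add: mult.left_commute flip: integral_mult_right_zero)
  also have "\<dots> = - (\<integral>t. (\<integral>x. indicator {0..1} t * (u x * ?D (x - t *\<^sub>R h)) \<partial>lborel) \<partial>lborel)"
    by (subst lborel_pair.Fubini_integral[OF int]) simp
  also have "\<dots> = - (\<integral>t. indicator {0..1} t * - (\<integral>x. \<phi> (x - t *\<^sub>R h) * (g x \<bullet> h) \<partial>lborel) \<partial>lborel)"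
  proof -
    have "(\<integral>x. u x * ?D (x - t *\<^sub>R h) \<partial>lborel) = - (\<integral>x. \<phi> (x - t *\<^sub>R h) * (g x \<bullet> h) \<partial>lborel)" for t
      using weak_directional[OF test_function_translate[OF \<phi>, of "- (t *\<^sub>R h)"], of h]
        frechet_derivative_translate[OF \<phi>, of "- (t *\<^sub>R h)"] by simp
    then show ?thesis by simp
  qed
  also have "\<dots> = (\<integral>t. indicator {0..1} t * (\<integral>x. \<phi> (x - t *\<^sub>R h) * (g x \<bullet> h) \<partial>lborel) \<partial>lborel)"
    by simp
  also have "\<dots> = (\<integral>x. \<phi> x * segment_average h (\<lambda>x. g x \<bullet> h) x \<partial>lborel)"
    by (rule integral_mult_segment_average[OF borel_loc_integrable_inner[OF g] _ C, symmetric]) simp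
  finally show ?thesis .
qed

text \<open>Test integrals of the discrepancy vanish, so the positivity criterion applies to it and
  to its negative. The exceptional null set may depend on \<open>h\<close>; the consequences are
  drawn for one \<open>h\<close> at a time.\<close>

proposition AE_difference_eq_segment_average:
  "AE x in lborel. u (x + h) - u x = segment_average h (\<lambda>x. g x \<bullet> h) x"
proof -
  let ?A = "segment_average h (\<lambda>x. g x \<bullet> h)"
  let ?d = "\<lambda>x. u (x + h) - u x"
  have d: "borel_loc_integrable ?d"
    by (intro borel_loc_integrable_diff borel_loc_integrable_translate u)
  have A: "borel_loc_integrable ?A"
    by (intro borel_loc_integrable_segment_average borel_loc_integrable_inner g)
  have eq: "(\<integral>x. \<phi> x * (?d x - ?A x) \<partial>lborel) = 0" if \<phi>: "test_function \<phi>" for \<phi>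
  proof -
    obtain C r where C: "\<And>x. \<bar>\<phi> x\<bar> \<le> C * indicator (cball 0 r) x"
      using test_function_bound[OF \<phi>] by blast
    have m: "\<phi> \<in> borel_measurable borel"
      by (rule borel_measurable_continuous_onI[OF test_function_continuous[OF \<phi>]])
    have "(\<integral>x. \<phi> x * (?d x - ?A x) \<partial>lborel) = (\<integral>x. \<phi> x *\<^sub>R ?d x - \<phi> x *\<^sub>R ?A x \<partial>lborel)"
      by (simp add: algebra_simps)
    also have "\<dots> = (\<integral>x. \<phi> x *\<^sub>R ?d x \<partial>lborel) - (\<integral>x. \<phi> x *\<^sub>R ?A x \<partial>lborel)"
      by (intro Bochner_Integration.integral_diff integrable_mult_borel_loc_integrable[OF d m C]
          integrable_mult_borel_loc_integrable[OF A m C])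
    also have "\<dots> = 0"
      using test_integral_difference[OF \<phi>] by simp
    finally show ?thesis .
  qed
  have "AE x in lborel. 0 \<le> ?d x - ?A x"
    by (rule AE_nonneg_if_test_integrals_nonneg[OF borel_loc_integrable_diff[OF d A]]) (simp add: eq)
  moreover have "AE x in lborel. 0 \<le> ?A x - ?d x"
  proof (rule AE_nonneg_if_test_integrals_nonneg[OF borel_loc_integrable_diff[OF A d]])
    show "0 \<le> (\<integral>x. \<phi> x * (?A x - ?d x) \<partial>lborel)" if "test_function \<phi>" for \<phi>
    proof -
      have "(\<integral>x. \<phi> x * (?A x - ?d x) \<partial>lborel) = (\<integral>x. - (\<phi> x * (?d x - ?A x)) \<partial>lborel)"
        by (simp add: algebra_simps)
      then show ?thesis using eq[OF that] by simp
    qed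
  qed
  ultimately show ?thesis by eventually_elim auto
qed

end

section \<open>The measure \<open>\<nu>\<^sub>0\<close> and small difference quotients in cones\<close>

lemma sigma_finite_lebesgue: "sigma_finite_measure (lebesgue :: 'a::euclidean_space measure)"
proof
  show "\<exists>A. countable A \<and> A \<subseteq> sets lebesgue \<and> \<Union>A = space (lebesgue :: 'a measure) \<and>
      (\<forall>a\<in>A. emeasure lebesgue a \<noteq> \<infinity>)"
  proof (intro exI conjI)
    show "countable (range (\<lambda>n::nat. cball (0::'a) n))" by simp
    show "\<Union>(range (\<lambda>n::nat. cball (0::'a) n)) = space lebesgue"
      by (auto simp: real_arch_simple)
    show "\<forall>a\<in>range (\<lambda>n::nat. cball (0::'a) n). emeasure lebesgue a \<noteq> \<infinity>"
      using emeasure_lborel_cball_finite by (auto simp: less_top[symmetric])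
  qed auto
qed

lemma nu0_eq:
  fixes u v :: "'a::euclidean_space \<Rightarrow> real"
  assumes u[measurable]: "u \<in> borel_measurable lebesgue" and v[measurable]: "v \<in> borel_measurable borel"
    and uv: "AE x in lborel. u x = v x"
  shows "nu0 (E_lam0 u lam) = (\<integral>\<^sup>+h. ennreal (1 / norm h ^ DIM('a)) *
    emeasure lborel {x. lam * norm h < \<bar>v (x + h) - v x\<bar>} \<partial>lborel)"
proof -
  interpret L: sigma_finite_measure "lebesgue :: 'a measure"
    by (rule sigma_finite_lebesgue)
  define k where "k z = ennreal (1 / norm z ^ DIM('a))" for z :: 'a
  have [measurable]: "k \<in> borel_measurable borel" unfolding k_def by measurable
  define S where "S w = {p. lam * norm (fst p - snd p) < \<bar>w (fst p) - w (snd p)\<bar>}"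
    for w :: "'a \<Rightarrow> real"
  \<comment> \<open>Multiplied out, the inequality reads \<open>0 < 0\<close> on the diagonal, so
    the condition \<open>x \<noteq> y\<close> is absorbed.\<close>
  have E: "E_lam0 u lam \<inter> {p. fst p \<noteq> snd p} = S u"
  proof -
    have "x \<noteq> y \<and> lam < \<bar>u x - u y\<bar> / norm (x - y) \<longleftrightarrow> lam * norm (x - y) < \<bar>u x - u y\<bar>" for x y
      by (cases "x = y") (auto simp: pos_less_divide_eq)
    then show ?thesis by (auto simp: E_lam0_def S_def)
  qed
  have id: "(\<lambda>x. x) \<in> lebesgue \<rightarrow>\<^sub>M (borel :: 'a measure)"
    by (rule measurable_completion) simp
  have [measurable]: "fst \<in> lebesgue \<Otimes>\<^sub>M lebesgue \<rightarrow>\<^sub>M (borel :: 'a measure)"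
      "snd \<in> lebesgue \<Otimes>\<^sub>M lebesgue \<rightarrow>\<^sub>M (borel :: 'a measure)"
    using measurable_compose[OF measurable_fst id] measurable_compose[OF measurable_snd id] by auto
  have uf[measurable]: "(\<lambda>p. u (fst p)) \<in> borel_measurable (lebesgue \<Otimes>\<^sub>M lebesgue)"
      "(\<lambda>p. u (snd p)) \<in> borel_measurable (lebesgue \<Otimes>\<^sub>M lebesgue)"
    using measurable_compose[OF measurable_fst u] measurable_compose[OF measurable_snd u] by auto
  have "{p \<in> space (lebesgue \<Otimes>\<^sub>M lebesgue). lam * norm (fst p - snd p) < \<bar>u (fst p) - u (snd p)\<bar>}
      \<in> sets (lebesgue \<Otimes>\<^sub>M lebesgue)"
    by measurable
  then have [measurable]: "S u \<in> sets (lebesgue \<Otimes>\<^sub>M lebesgue)"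
    by (simp add: S_def space_pair_measure)
  have "{p \<in> space (borel \<Otimes>\<^sub>M borel). lam * norm (fst p - snd p) < \<bar>v (fst p) - v (snd p)\<bar>}
      \<in> sets (borel \<Otimes>\<^sub>M borel)"
    by measurable
  then have [measurable]: "S v \<in> sets (borel \<Otimes>\<^sub>M borel)"
    by (simp add: S_def space_pair_measure)
  have "nu0 (E_lam0 u lam) =
      (\<integral>\<^sup>+p. indicator (S u) p * k (fst p - snd p) \<partial>(lebesgue \<Otimes>\<^sub>M lebesgue))"
    by (simp add: nu0_def E k_def)
  also have "\<dots> = (\<integral>\<^sup>+x. \<integral>\<^sup>+y. indicator (S u) (x, y) * k (x - y) \<partial>lebesgue \<partial>lebesgue)"
    by (subst L.nn_integral_fst[symmetric]) auto
  also have "\<dots> = (\<integral>\<^sup>+x. \<integral>\<^sup>+y. indicator (S u) (x, y) * k (x - y) \<partial>lborel \<partial>lborel)"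
    by (simp add: nn_integral_completion)
  also have "\<dots> = (\<integral>\<^sup>+x. \<integral>\<^sup>+y. indicator (S v) (x, y) * k (x - y) \<partial>lborel \<partial>lborel)"
  proof (rule nn_integral_cong_AE)
    show "AE x in lborel. (\<integral>\<^sup>+y. indicator (S u) (x, y) * k (x - y) \<partial>lborel) =
        (\<integral>\<^sup>+y. indicator (S v) (x, y) * k (x - y) \<partial>lborel)"
      using uv
    proof eventually_elim
      case (elim x)
      show ?case
      proof (rule nn_integral_cong_AE)
        show "AE y in lborel. indicator (S u) (x, y) * k (x - y) = indicator (S v) (x, y) * k (x - y)"
          using uv by eventually_elim (simp add: S_def indicator_def elim)
      qed
    qed
  qed
  also have "\<dots> = (\<integral>\<^sup>+x. \<integral>\<^sup>+h. indicator (S v) (x, h + x) * k h \<partial>lborel \<partial>lborel)"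
  proof (rule nn_integral_cong)
    fix x
    show "(\<integral>\<^sup>+y. indicator (S v) (x, y) * k (x - y) \<partial>lborel) =
        (\<integral>\<^sup>+h. indicator (S v) (x, h + x) * k h \<partial>lborel)"
      using nn_integral_translate[of "\<lambda>y. indicator (S v) (x, y) * k (x - y)" x]
      by (simp add: k_def)
  qed
  also have "\<dots> = (\<integral>\<^sup>+h. \<integral>\<^sup>+x. indicator (S v) (x, h + x) * k h \<partial>lborel \<partial>lborel)"
    by (rule lborel_pair.Fubini') measurable
  also have "\<dots> = (\<integral>\<^sup>+h. k h * emeasure lborel {x. lam * norm h < \<bar>v (x + h) - v x\<bar>} \<partial>lborel)"
  proof (rule nn_integral_cong)
    fix h
    have "(\<integral>\<^sup>+x. indicator (S v) (x, h + x) * k h \<partial>lborel) =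
        (\<integral>\<^sup>+x. k h * indicator {x. lam * norm h < \<bar>v (x + h) - v x\<bar>} x \<partial>lborel)"
      by (intro nn_integral_cong) (auto simp: S_def indicator_def add.commute abs_minus_commute)
    also have "\<dots> = k h * emeasure lborel {x. lam * norm h < \<bar>v (x + h) - v x\<bar>}"
      by (rule nn_integral_cmult_indicator) measurable
    finally show "(\<integral>\<^sup>+x. indicator (S v) (x, h + x) * k h \<partial>lborel) =
        k h * emeasure lborel {x. lam * norm h < \<bar>v (x + h) - v x\<bar>}" .
  qed
  finally show ?thesis by (simp add: k_def)
qed

text \<open>The closeness of the direction of \<open>h\<close> to \<open>\<omega>\<close> is
  multiplied by \<open>norm h\<close>; the strict inequality then excludes the origin.\<close>

definition direction_cone :: "'a::euclidean_space \<Rightarrow> real \<Rightarrow> real \<Rightarrow> 'a set" where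
  "direction_cone \<omega> \<delta> s = {h. norm h < s \<and> norm (h - norm h *\<^sub>R \<omega>) < \<delta> * norm h}"

text \<open>The kernel is invariant under dilations, so if the integral were finite, the part of the
  cone with \<open>s / 2 \<le> norm h\<close> would be a null set.\<close>

lemma nn_integral_cone:
  fixes \<omega> :: "'a::euclidean_space"
  assumes \<omega>: "norm \<omega> = 1" and \<delta>: "\<delta> > 0" and s: "s > 0"
  shows "(\<integral>\<^sup>+h. indicator (direction_cone \<omega> \<delta> s) h * ennreal (1 / norm h ^ DIM('a)) \<partial>lborel) = \<infinity>"
proof (rule ccontr)
  define k where "k z = ennreal (1 / norm z ^ DIM('a))" for z :: 'a
  have [measurable]: "k \<in> borel_measurable borel" unfolding k_def by measurable
  have [measurable]: "direction_cone \<omega> \<delta> s \<in> sets borel" for s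
    unfolding direction_cone_def by measurable
  let ?I = "\<lambda>s. \<integral>\<^sup>+h. indicator (direction_cone \<omega> \<delta> s) h * k h \<partial>lborel"
  assume "(\<integral>\<^sup>+h. indicator (direction_cone \<omega> \<delta> s) h * ennreal (1 / norm h ^ DIM('a)) \<partial>lborel) \<noteq> \<infinity>"
  then have fin: "?I s \<noteq> \<infinity>" by (simp add: k_def)
  have half: "(1 / 2) *\<^sub>R h \<in> direction_cone \<omega> \<delta> (s / 2) \<longleftrightarrow> h \<in> direction_cone \<omega> \<delta> s" for h
  proof -
    have "(1 / 2) *\<^sub>R h - norm ((1 / 2) *\<^sub>R h) *\<^sub>R \<omega> = (1 / 2) *\<^sub>R (h - norm h *\<^sub>R \<omega>)"
      by (simp add: algebra_simps)
    then have "norm ((1 / 2) *\<^sub>R h - norm ((1 / 2) *\<^sub>R h) *\<^sub>R \<omega>) = norm (h - norm h *\<^sub>R \<omega>) / 2"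
      by simp
    then show ?thesis by (auto simp: direction_cone_def)
  qed
  have "?I (s / 2) = (\<integral>\<^sup>+h. indicator (direction_cone \<omega> \<delta> (s / 2)) h * k h
      \<partial>density (distr lborel borel (\<lambda>x. 0 + (1 / 2) *\<^sub>R x)) (\<lambda>_. ennreal (\<bar>1 / 2\<bar> ^ DIM('a))))"
    by (subst lborel_affine[of "1 / 2" 0, symmetric]) auto
  also have "\<dots> = (\<integral>\<^sup>+h. ennreal (\<bar>1 / 2\<bar> ^ DIM('a)) *
      (indicator (direction_cone \<omega> \<delta> (s / 2)) ((1 / 2) *\<^sub>R h) * k ((1 / 2) *\<^sub>R h)) \<partial>lborel)"
    by (simp add: nn_integral_density nn_integral_distr)
  also have "\<dots> = ?I s"
  proof (intro nn_integral_cong)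
    fix h :: 'a
    \<comment> \<open>The Jacobian of the dilation by 1/2 cancels the scaling factor of the kernel
      exactly; this is where the exponent \<open>DIM('a)\<close> matters.\<close>
    have k: "ennreal (\<bar>1 / 2\<bar> ^ DIM('a)) * k ((1 / 2) *\<^sub>R h) = k h"
      unfolding k_def by (subst ennreal_mult[symmetric]) (auto simp: power_divide)
    have ind: "indicator (direction_cone \<omega> \<delta> (s / 2)) ((1 / 2) *\<^sub>R h) =
        (indicator (direction_cone \<omega> \<delta> s) h :: ennreal)"
      unfolding indicator_def half ..
    show "ennreal (\<bar>1 / 2\<bar> ^ DIM('a)) * (indicator (direction_cone \<omega> \<delta> (s / 2)) ((1 / 2) *\<^sub>R h) *
        k ((1 / 2) *\<^sub>R h)) = indicator (direction_cone \<omega> \<delta> s) h * k h"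
      unfolding ind by (subst mult.left_commute) (simp only: k)
  qed
  finally have eq: "?I (s / 2) = ?I s" .
  define S where "S = direction_cone \<omega> \<delta> s - direction_cone \<omega> \<delta> (s / 2)"
  have [measurable]: "S \<in> sets borel" by (simp add: S_def)
  have "?I s = (\<integral>\<^sup>+h. indicator (direction_cone \<omega> \<delta> (s / 2)) h * k h + indicator S h * k h \<partial>lborel)"
    using s by (intro nn_integral_cong) (auto simp: S_def direction_cone_def indicator_def)
  also have "\<dots> = ?I s + (\<integral>\<^sup>+h. indicator S h * k h \<partial>lborel)"
    by (subst nn_integral_add) (auto simp: eq)
  finally have "(\<integral>\<^sup>+h. indicator S h * k h \<partial>lborel) = 0"
    using fin by (metis add.right_neutral ennreal_add_left_cancel infinity_ennreal_def)
  then have "AE h in lborel. indicator S h * k h = 0"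
    by (subst (asm) nn_integral_0_iff_AE) auto
  then have ae: "AE h in lborel. h \<notin> S"
  proof eventually_elim
    case (elim h)
    show ?case
    proof
      assume "h \<in> S"
      moreover from this have "h \<noteq> 0" by (auto simp: S_def direction_cone_def)
      ultimately show False using elim by (auto simp: k_def)
    qed
  qed
  \<comment> \<open>With strict inequalities throughout, \<open>T\<close> is an open part of
    \<open>S\<close>. It contains \<open>(3 / 4 * s) *\<^sub>R \<omega>\<close>, so it cannot be a
    null set.\<close>
  define T where "T = {h. s / 2 < norm h \<and> norm h < s \<and> norm (h - norm h *\<^sub>R \<omega>) < \<delta> * norm h}"
  have "open T"
    unfolding T_def by (intro open_Collect_conj open_Collect_less continuous_intros)
  moreover have "(3 / 4 * s) *\<^sub>R \<omega> \<in> T"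
    using \<omega> \<delta> s by (simp add: T_def)
  moreover have "AE h in lborel. h \<notin> T"
    using ae by eventually_elim (auto simp: T_def S_def direction_cone_def)
  then have "T \<in> null_sets lborel"
    using \<open>open T\<close> by (subst AE_iff_null_sets) auto
  then have "negligible T"
    by (simp add: negligible_iff_null_sets null_sets_completionI)
  ultimately show False
    using open_not_negligible by blast
qed

text \<open>If no such \<open>h\<close> existed, \<open>m\<close> would be at least
  \<open>\<delta>\<close> on the whole cone, whose kernel integral is infinite. One parameter bounds
  length, direction and value, so letting it tend to 0 yields a sequence with all three
  limits.\<close>

lemma small_value_in_cone:
  fixes \<omega> :: "'a::euclidean_space" and m :: "'a \<Rightarrow> ennreal"
  assumes \<omega>: "norm \<omega> = 1" and \<delta>: "\<delta> > 0"
    and fin: "(\<integral>\<^sup>+h. ennreal (1 / norm h ^ DIM('a)) * m h \<partial>lborel) < \<infinity>"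
  shows "\<exists>h. 0 < norm h \<and> norm h < \<delta> \<and> norm (h - norm h *\<^sub>R \<omega>) < \<delta> * norm h \<and> m h < ennreal \<delta>"
proof (rule ccontr)
  assume no: "\<not> ?thesis"
  have ge: "ennreal \<delta> \<le> m h" if h: "h \<in> direction_cone \<omega> \<delta> \<delta>" for h
  proof -
    have "0 < norm h" using h by (cases "h = 0") (auto simp: direction_cone_def)
    with no h show ?thesis by (force simp: direction_cone_def not_less)
  qed
  have [measurable]: "direction_cone \<omega> \<delta> \<delta> \<in> sets borel"
    unfolding direction_cone_def by measurable
  have "\<infinity> = ennreal \<delta> * (\<integral>\<^sup>+h. indicator (direction_cone \<omega> \<delta> \<delta>) h * ennreal (1 / norm h ^ DIM('a)) \<partial>lborel)"
    using \<delta> by (simp add: nn_integral_cone[OF \<omega> \<delta> \<delta>] ennreal_mult_top)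
  also have "\<dots> = (\<integral>\<^sup>+h. ennreal \<delta> * (indicator (direction_cone \<omega> \<delta> \<delta>) h * ennreal (1 / norm h ^ DIM('a))) \<partial>lborel)"
    by (rule nn_integral_cmult[symmetric]) measurable
  also have "\<dots> \<le> (\<integral>\<^sup>+h. ennreal (1 / norm h ^ DIM('a)) * m h \<partial>lborel)"
    by (intro nn_integral_mono) (auto simp: indicator_def mult.commute intro: mult_left_mono mult_right_mono ge)
  finally show False using fin by simp
qed

section \<open>Bounds for the gradient\<close>

context borel_weak_gradient
begin

lemma AE_difference_le:
  assumes L: "AE x in lborel. norm (g x) \<le> L" and "0 \<le> L"
  shows "AE x in lborel. \<bar>u (x + h) - u x\<bar> \<le> L * norm h"
proof -
  have "AE t in lborel. AE x in lborel. norm (g (x + t *\<^sub>R h)) \<le> L" for h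
    by (intro AE_I2 AE_translate[OF L]) measurable
  \<comment> \<open>For each \<open>t\<close> the bound holds off a null set of \<open>x\<close>;
    Fubini exchanges the two quantifiers, giving the bound almost everywhere along almost every
    segment.\<close>
  then have "AE x in lborel. AE t in lborel. norm (g (x + t *\<^sub>R h)) \<le> L"
    by (subst lborel_pair.AE_commute) measurable
  with AE_difference_eq_segment_average[of h] show ?thesis
  proof eventually_elim
    case (elim x)
    have "\<bar>u (x + h) - u x\<bar> \<le> (\<integral>t. \<bar>indicator {0..1} t * (g (x + t *\<^sub>R h) \<bullet> h)\<bar> \<partial>lborel)"
      unfolding elim(1) segment_average_def using integral_norm_bound[of lborel] by simp
    also have "\<dots> \<le> (\<integral>t. indicator {0..1} t *\<^sub>R (L * norm h) \<partial>(lborel :: real measure))"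
    proof (rule integral_mono_AE')
      show "AE t in lborel. \<bar>indicator {0..1} t * (g (x + t *\<^sub>R h) \<bullet> h)\<bar> \<le> indicator {0..1} t *\<^sub>R (L * norm h)"
        using elim(2)
      proof eventually_elim
        case (elim t)
        have "\<bar>g (x + t *\<^sub>R h) \<bullet> h\<bar> \<le> norm (g (x + t *\<^sub>R h)) * norm h"
          by (rule Cauchy_Schwarz_ineq2)
        also have "\<dots> \<le> L * norm h"
          by (intro mult_right_mono elim) simp
        finally show ?case by (simp add: indicator_def)
      qed
    qed (use \<open>0 \<le> L\<close> in auto)
    finally show ?case by simp
  qed
qed

text \<open>With the shift in the continuous \<open>\<phi>\<close> and the direction in
  \<open>w n\<close>, the integrands of \<open>K n t\<close> converge pointwise. Dominated
  convergence is used twice, in \<open>x\<close> with majorant \<open>W\<close> and in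
  \<open>t\<close> with a constant; \<open>norm (h n) \<le> 1\<close> keeps all supports in the ball
  of radius \<open>r + 1\<close>.\<close>

lemma test_integral_tendsto:
  assumes \<phi>: "test_function \<phi>" and h0: "\<And>n. 0 < norm (h n)" and h1: "\<And>n. norm (h n) \<le> 1"
    and h: "h \<longlonglongrightarrow> 0" and \<omega>: "(\<lambda>n. h n /\<^sub>R norm (h n)) \<longlonglongrightarrow> \<omega>"
  shows "(\<lambda>n. (\<integral>x. \<phi> x * (u (x + h n) - u x) \<partial>lborel) / norm (h n)) \<longlonglongrightarrow> (\<integral>x. \<phi> x * (g x \<bullet> \<omega>) \<partial>lborel)"
proof -
  have cont: "continuous_on UNIV \<phi>" by (rule test_function_continuous[OF \<phi>])
  have [measurable]: "\<phi> \<in> borel_measurable borel"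
    by (rule borel_measurable_continuous_onI[OF cont])
  obtain C r where C: "\<And>x. \<bar>\<phi> x\<bar> \<le> C * indicator (cball 0 r) x"
    using test_function_bound[OF \<phi>] by blast
  define w where "w n = h n /\<^sub>R norm (h n)" for n
  have w1: "norm (w n) = 1" for n using h0[of n] by (simp add: w_def)
  define W where "W x = (\<bar>C\<bar> * indicator (cball 0 (r + 1)) x) *\<^sub>R norm (g x)" for x
  have "borel_loc_integrable (\<lambda>x. norm (g x))"
    by (rule borel_loc_integrable_bound[OF g]) auto
  then have W: "integrable lborel W"
    unfolding W_def
    by (rule integrable_mult_borel_loc_integrable[where C = "\<bar>C\<bar>" and r = "r + 1"])
      (auto simp: indicator_def)
  define K where "K n t = (\<integral>x. \<phi> (x - t *\<^sub>R h n) * (g x \<bullet> w n) \<partial>lborel)" for n t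
  have bound: "norm (\<phi> (x - t *\<^sub>R h n) * (g x \<bullet> w n)) \<le> W x" if t: "t \<in> {0..1}" for t x n
  proof -
    have "\<bar>\<phi> (x - t *\<^sub>R h n)\<bar> \<le> \<bar>C\<bar> * indicator (cball 0 (r + norm (h n))) x"
      by (rule translate_bound[OF C t])
    also have "\<dots> \<le> \<bar>C\<bar> * indicator (cball 0 (r + 1)) x"
      using h1[of n] by (auto simp: indicator_def)
    finally have "\<bar>\<phi> (x - t *\<^sub>R h n)\<bar> \<le> \<bar>C\<bar> * indicator (cball 0 (r + 1)) x" .
    moreover have "\<bar>g x \<bullet> w n\<bar> \<le> norm (g x)"
      using Cauchy_Schwarz_ineq2[of "g x" "w n"] w1 by simp
    ultimately show ?thesis
      unfolding W_def by (auto simp: abs_mult intro!: mult_mono)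
  qed
  have K_lim: "(\<lambda>n. K n t) \<longlonglongrightarrow> (\<integral>x. \<phi> x * (g x \<bullet> \<omega>) \<partial>lborel)" if t: "t \<in> {0..1}" for t
    unfolding K_def
  proof (rule integral_dominated_convergence[OF _ _ W])
    show "AE x in lborel. (\<lambda>n. \<phi> (x - t *\<^sub>R h n) * (g x \<bullet> w n)) \<longlonglongrightarrow> \<phi> x * (g x \<bullet> \<omega>)"
    proof (rule AE_I2)
      fix x
      have "(\<lambda>n. x - t *\<^sub>R h n) \<longlonglongrightarrow> x - t *\<^sub>R 0"
        by (intro tendsto_intros h)
      then have "(\<lambda>n. \<phi> (x - t *\<^sub>R h n)) \<longlonglongrightarrow> \<phi> x"
        using cont by (intro isCont_tendsto_compose[of x \<phi>]) (auto simp: continuous_on_eq_continuous_at)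
      then show "(\<lambda>n. \<phi> (x - t *\<^sub>R h n) * (g x \<bullet> w n)) \<longlonglongrightarrow> \<phi> x * (g x \<bullet> \<omega>)"
        using \<omega> unfolding w_def by (intro tendsto_intros)
    qed
  qed (use bound[OF t] in auto)
  have K_bound: "norm (K n t) \<le> (\<integral>x. W x \<partial>lborel)" if "t \<in> {0..1}" for n t
    unfolding K_def using bound[OF that]
    by (intro order_trans[OF integral_norm_bound] integral_mono_AE' W) (auto simp: W_def)
  have "(\<lambda>n. \<integral>t. indicator {0..1} t * K n t \<partial>lborel) \<longlonglongrightarrow>
      (\<integral>t. indicator {0..1} t * (\<integral>x. \<phi> x * (g x \<bullet> \<omega>) \<partial>lborel) \<partial>(lborel :: real measure))"
  proof (rule integral_dominated_convergence)
    show "integrable lborel (\<lambda>t::real. indicator {0..1} t *\<^sub>R (\<integral>x. W x \<partial>lborel))" by simp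
    show "AE t in lborel. norm (indicator {0..1} t * K n t) \<le> indicator {0..1} t *\<^sub>R (\<integral>x. W x \<partial>lborel)" for n
      using K_bound by (auto simp: indicator_def)
    show "AE t in lborel. (\<lambda>n. indicator {0..1} t * K n t) \<longlonglongrightarrow>
        indicator {0..1} t * (\<integral>x. \<phi> x * (g x \<bullet> \<omega>) \<partial>lborel)"
      using K_lim by (auto simp: indicator_def)
    show "(\<lambda>t. indicator {0..1} t * K n t) \<in> borel_measurable lborel" for n
      unfolding K_def by measurable
  qed measurable
  moreover have "(\<integral>t. indicator {0..1} t * K n t \<partial>lborel) =
      (\<integral>x. \<phi> x * (u (x + h n) - u x) \<partial>lborel) / norm (h n)" for n
  proof -
    have "(\<integral>x. \<phi> x * (u (x + h n) - u x) \<partial>lborel) =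
        (\<integral>t. indicator {0..1} t * (\<integral>x. \<phi> (x - t *\<^sub>R h n) * (g x \<bullet> h n) \<partial>lborel) \<partial>lborel)"
      unfolding test_integral_difference[OF \<phi>]
      by (rule integral_mult_segment_average[OF borel_loc_integrable_inner[OF g] _ C]) simp
    also have "\<dots> = (\<integral>t. norm (h n) * (indicator {0..1} t * K n t) \<partial>lborel)"
    proof (rule Bochner_Integration.integral_cong)
      fix t
      have "g x \<bullet> h n = norm (h n) * (g x \<bullet> w n)" for x
        using h0[of n] by (simp add: w_def)
      then show "indicator {0..1} t * (\<integral>x. \<phi> (x - t *\<^sub>R h n) * (g x \<bullet> h n) \<partial>lborel) =
          norm (h n) * (indicator {0..1} t * K n t)"
        by (simp add: K_def mult.left_commute[of _ "norm (h n)"])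
    qed simp
    also have "\<dots> = norm (h n) * (\<integral>t. indicator {0..1} t * K n t \<partial>lborel)" by simp
    finally show ?thesis using h0[of n] by simp
  qed
  ultimately show ?thesis by simp
qed

section \<open>Truncated gradients and the directional bound\<close>

definition excess :: "real \<Rightarrow> 'a \<Rightarrow> real" where
  "excess R x = max 0 (norm (g x) - R)"

lemma borel_loc_integrable_excess:
  assumes "0 \<le> R"
  shows "borel_loc_integrable (excess R)"
  unfolding excess_def using assms by (intro borel_loc_integrable_bound[OF g]) auto

text \<open>\<open>norm (g y) \<le> R + excess R y\<close> is integrated along the segment.
  Integrability of the majorant is essential, since a divergent integral would be read as 0.\<close>

lemma AE_difference_le_excess:
  assumes R: "0 \<le> R"
  shows "AE x in lborel. \<bar>u (x + h) - u x\<bar> \<le> norm h * (R + segment_average h (excess R) x)"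
  using AE_difference_eq_segment_average[of h]
    AE_integrable_on_segment[OF borel_loc_integrable_excess[OF R], of h]
proof eventually_elim
  case (elim x)
  have i: "integrable lborel (\<lambda>t::real. indicator {0..1} t *\<^sub>R (norm h * R))" by simp
  have j: "integrable lborel (\<lambda>t. norm h * (indicator {0..1} t * excess R (x + t *\<^sub>R h)))"
    using elim(2) by simp
  have "\<bar>u (x + h) - u x\<bar> \<le> (\<integral>t. \<bar>indicator {0..1} t * (g (x + t *\<^sub>R h) \<bullet> h)\<bar> \<partial>lborel)"
    unfolding elim(1) segment_average_def using integral_norm_bound[of lborel] by simp
  also have "\<dots> \<le> (\<integral>t. indicator {0..1} t *\<^sub>R (norm h * R) +
      norm h * (indicator {0..1} t * excess R (x + t *\<^sub>R h)) \<partial>lborel)"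
  proof (rule integral_mono_AE'[OF Bochner_Integration.integrable_add[OF i j]])
    have "\<bar>g y \<bullet> h\<bar> \<le> norm h * R + norm h * excess R y" for y
    proof -
      have "\<bar>g y \<bullet> h\<bar> \<le> norm h * norm (g y)"
        using Cauchy_Schwarz_ineq2[of "g y" h] by (simp add: mult.commute)
      also have "\<dots> \<le> norm h * (R + excess R y)"
        by (intro mult_left_mono) (auto simp: excess_def)
      finally show ?thesis by (simp add: distrib_left)
    qed
    then show "AE t in lborel. \<bar>indicator {0..1} t * (g (x + t *\<^sub>R h) \<bullet> h)\<bar> \<le>
        indicator {0..1} t *\<^sub>R (norm h * R) + norm h * (indicator {0..1} t * excess R (x + t *\<^sub>R h))"
      by (auto simp: indicator_def)
  qed (use R in \<open>auto simp: excess_def\<close>)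
  also have "\<dots> = norm h * R + norm h * segment_average h (excess R) x"
    unfolding segment_average_def by (subst Bochner_Integration.integral_add[OF i j]) simp
  finally show ?case by (simp add: distrib_left)
qed

text \<open>On the set where the difference quotient exceeds \<open>lam\<close>, it is controlled by splitting
  the gradient at height \<open>R\<close>; this replaces uniform integrability of the quotients.\<close>

lemma test_integral_difference_le:
  assumes \<phi>: "test_function \<phi>" and \<phi>0: "\<And>x. 0 \<le> \<phi> x" and C: "\<And>x. \<bar>\<phi> x\<bar> \<le> C * indicator (cball 0 r) x"
    and C0: "0 \<le> C" and h: "norm h \<le> 1" and lam: "0 \<le> lam" and R: "0 \<le> R" and e: "0 \<le> e"
    and small: "emeasure lborel {x. lam * norm h < \<bar>u (x + h) - u x\<bar>} \<le> ennreal e"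
  shows "(\<integral>x. \<phi> x * (u (x + h) - u x) \<partial>lborel) \<le> norm h * (lam * (\<integral>x. \<phi> x \<partial>lborel) + R * C * e +
    C * (\<integral>x. indicator (cball 0 (r + 1)) x * excess R x \<partial>lborel))"
proof -
  define B where "B = {x. lam * norm h < \<bar>u (x + h) - u x\<bar>}"
  let ?A = "segment_average h (excess R)"
  have [measurable]: "\<phi> \<in> borel_measurable borel"
    by (rule borel_measurable_continuous_onI[OF test_function_continuous[OF \<phi>]])
  have [measurable]: "B \<in> sets borel" unfolding B_def by measurable
  have B_fin: "emeasure lborel B < \<infinity>"
    using small by (auto simp: B_def intro: le_less_trans)
  have B_le: "measure lborel B \<le> e"
    using small e by (simp add: B_def measure_def enn2real_leI)
  have exc: "borel_loc_integrable (excess R)" by (rule borel_loc_integrable_excess[OF R])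
  have exc0: "0 \<le> excess R x" for x by (simp add: excess_def)
  have A0: "0 \<le> ?A x" for x
    unfolding segment_average_def by (intro integral_nonneg_AE AE_I2) (simp add: exc0)
  from integrable_mult_borel_loc_integrable[OF borel_loc_integrable_const[of 1] _ C]
  have i1: "integrable lborel \<phi>" by simp
  have i2: "integrable lborel (\<lambda>x. indicator B x :: real)"
    using B_fin by (simp add: integrable_indicator_iff)
  have i3: "integrable lborel (\<lambda>x. \<phi> x * ?A x)"
    by (rule integrable_mult_segment_average[OF exc _ C]) simp
  have i0: "integrable lborel (\<lambda>x. \<phi> x * (u (x + h) - u x))"
    using integrable_mult_borel_loc_integrable[OF
        borel_loc_integrable_diff[OF borel_loc_integrable_translate[OF u] u] _ C] by simp
  have "(\<integral>x. \<phi> x * (u (x + h) - u x) \<partial>lborel) \<le>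
      (\<integral>x. norm h * (lam * \<phi> x + R * C * indicator B x + \<phi> x * ?A x) \<partial>lborel)"
  proof (rule integral_mono_AE[OF i0])
    show "integrable lborel (\<lambda>x. norm h * (lam * \<phi> x + R * C * indicator B x + \<phi> x * ?A x))"
      using i1 i2 i3 by (intro integrable_mult_right Bochner_Integration.integrable_add)
    show "AE x in lborel. \<phi> x * (u (x + h) - u x) \<le>
        norm h * (lam * \<phi> x + R * C * indicator B x + \<phi> x * ?A x)"
      using AE_difference_le_excess[OF R, of h]
    proof eventually_elim
      case (elim x)
      have \<phi>C: "\<phi> x \<le> C" using C[of x] C0 by (cases "x \<in> cball 0 r") auto
      show ?case
      proof (cases "x \<in> B")
        case True
        \<comment> \<open>On \<open>B\<close> the level \<open>lam\<close> is lost, but the constant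
          \<open>R * C\<close> that replaces it is only paid on a set of measure at most
          \<open>e\<close>.\<close>
        have "\<phi> x * (u (x + h) - u x) \<le> \<phi> x * (norm h * (R + ?A x))"
          using elim by (intro mult_left_mono \<phi>0) auto
        also have "\<dots> = norm h * (R * \<phi> x + \<phi> x * ?A x)" by (simp add: algebra_simps)
        also have "\<dots> \<le> norm h * (lam * \<phi> x + R * C * indicator B x + \<phi> x * ?A x)"
        proof (rule mult_left_mono)
          have "R * \<phi> x \<le> R * C" by (intro mult_left_mono \<phi>C R)
          moreover have "0 \<le> lam * \<phi> x" using lam \<phi>0 by simp
          ultimately show "R * \<phi> x + \<phi> x * ?A x \<le> lam * \<phi> x + R * C * indicator B x + \<phi> x * ?A x"
            using True by simp
        qed simp
        finally show ?thesis .
      next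
        case False
        then have "\<phi> x * (u (x + h) - u x) \<le> \<phi> x * (lam * norm h)"
          by (intro mult_left_mono \<phi>0) (auto simp: B_def)
        also have "\<dots> \<le> norm h * (lam * \<phi> x + R * C * indicator B x + \<phi> x * ?A x)"
          using False A0[of x] \<phi>0[of x] by (simp add: algebra_simps)
        finally show ?thesis .
      qed
    qed
  qed
  also have "\<dots> = norm h * (lam * (\<integral>x. \<phi> x \<partial>lborel) + R * C * measure lborel B + (\<integral>x. \<phi> x * ?A x \<partial>lborel))"
    using i1 i2 i3 by simp
  also have "\<dots> \<le> norm h * (lam * (\<integral>x. \<phi> x \<partial>lborel) + R * C * e +
      C * (\<integral>x. indicator (cball 0 (r + 1)) x * excess R x \<partial>lborel))"
  proof (rule mult_left_mono)
    have small_part: "R * C * measure lborel B \<le> R * C * e"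
      using R C0 B_le by (intro mult_left_mono) auto
    let ?T = "C * (\<integral>x. indicator (cball 0 (r + 1)) x * excess R x \<partial>lborel)"
    have T: "?T = (\<integral>x. (C * indicator (cball 0 (r + 1)) x) *\<^sub>R excess R x \<partial>lborel)"
      by (simp add: mult.assoc)
    have T0: "0 \<le> ?T"
      using C0 exc0 by (intro mult_nonneg_nonneg integral_nonneg_AE) auto
    \<comment> \<open>Shifting \<open>\<phi>\<close> instead of \<open>excess R\<close> leads to a
      bound on a fixed ball that does not depend on \<open>h\<close>.\<close>
    have "(\<integral>x. \<phi> x * ?A x \<partial>lborel) =
        (\<integral>t. indicator {0..1} t * (\<integral>x. \<phi> (x - t *\<^sub>R h) * excess R x \<partial>lborel) \<partial>lborel)"
      by (rule integral_mult_segment_average[OF exc _ C]) simp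
    also have "\<dots> \<le> (\<integral>t. indicator {0..1} t *\<^sub>R ?T \<partial>(lborel :: real measure))"
    proof (rule integral_mono_AE')
      have "(\<integral>x. \<phi> (x - t *\<^sub>R h) * excess R x \<partial>lborel) \<le> ?T" if t: "t \<in> {0..1}" for t
        unfolding T
      proof (rule integral_mono_AE')
        show "integrable lborel (\<lambda>x. (C * indicator (cball 0 (r + 1)) x) *\<^sub>R excess R x)"
          by (rule integrable_mult_borel_loc_integrable[OF exc, where C = C and r = "r + 1"])
            (auto simp: indicator_def C0)
        have "\<phi> (x - t *\<^sub>R h) \<le> C * indicator (cball 0 (r + 1)) x" for x
        proof -
          have "\<phi> (x - t *\<^sub>R h) \<le> \<bar>C\<bar> * indicator (cball 0 (r + norm h)) x"
            using translate_bound[OF C t] by (meson abs_ge_self order_trans)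
          also have "\<dots> \<le> C * indicator (cball 0 (r + 1)) x"
            using h C0 by (auto simp: indicator_def)
          finally show ?thesis .
        qed
        then show "AE x in lborel. \<phi> (x - t *\<^sub>R h) * excess R x \<le> (C * indicator (cball 0 (r + 1)) x) *\<^sub>R excess R x"
          by (auto intro!: mult_right_mono exc0 simp del: mult.assoc)
        show "AE x in lborel. 0 \<le> (C * indicator (cball 0 (r + 1)) x) *\<^sub>R excess R x"
          using C0 exc0 by auto
      qed
      then show "AE t in lborel. indicator {0..1} t * (\<integral>x. \<phi> (x - t *\<^sub>R h) * excess R x \<partial>lborel) \<le>
          indicator {0..1} t *\<^sub>R ?T"
        by (auto simp: indicator_def)
    qed (use T0 in auto)
    finally have "(\<integral>x. \<phi> x * ?A x \<partial>lborel) \<le> ?T" by simp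
    with small_part show "lam * (\<integral>x. \<phi> x \<partial>lborel) + R * C * measure lborel B + (\<integral>x. \<phi> x * ?A x \<partial>lborel) \<le>
        lam * (\<integral>x. \<phi> x \<partial>lborel) + R * C * e + ?T" by linarith
  qed simp
  finally show ?thesis .
qed

text \<open>The order of limits matters: with \<open>R\<close> fixed, \<open>n\<close> tends to
  infinity and removes \<open>R * C * \<delta> n\<close>; only then does \<open>R\<close> grow, and
  local integrability of \<open>g\<close> removes the tail \<open>?T R\<close>.\<close>

proposition AE_gradient_direction_le:
  assumes lam: "0 \<le> lam" and \<omega>: "norm \<omega> = 1"
    and fin: "(\<integral>\<^sup>+h. ennreal (1 / norm h ^ DIM('a)) *
      emeasure lborel {x. lam * norm h < \<bar>u (x + h) - u x\<bar>} \<partial>lborel) < \<infinity>"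
  shows "AE x in lborel. g x \<bullet> \<omega> \<le> lam"
proof -
  define \<delta> where "\<delta> n = 1 / (real n + 1)" for n
  have \<delta>: "\<delta> n > 0" "\<delta> n \<le> 1" for n by (auto simp: \<delta>_def)
  have \<delta>0: "\<delta> \<longlonglongrightarrow> 0"
    unfolding \<delta>_def using LIMSEQ_inverse_real_of_nat by (simp add: inverse_eq_divide add.commute)
  have "\<forall>n. \<exists>h. 0 < norm h \<and> norm h < \<delta> n \<and> norm (h - norm h *\<^sub>R \<omega>) < \<delta> n * norm h \<and>
      emeasure lborel {x. lam * norm h < \<bar>u (x + h) - u x\<bar>} < ennreal (\<delta> n)"
    by (intro allI small_value_in_cone[OF \<omega> \<delta>(1) fin])
  note choice[OF this]
  then obtain h where h0: "\<And>n. 0 < norm (h n)" and h1: "\<And>n. norm (h n) < \<delta> n"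
    and dir: "\<And>n. norm (h n - norm (h n) *\<^sub>R \<omega>) < \<delta> n * norm (h n)"
    and small: "\<And>n. emeasure lborel {x. lam * norm (h n) < \<bar>u (x + h n) - u x\<bar>} < ennreal (\<delta> n)"
    by blast
  have h_lim: "h \<longlonglongrightarrow> 0"
    by (rule Lim_null_comparison[OF _ \<delta>0], intro always_eventually allI less_imp_le h1)
  have dir_lim: "(\<lambda>n. h n /\<^sub>R norm (h n)) \<longlonglongrightarrow> \<omega>"
  proof (rule LIM_zero_cancel, rule Lim_null_comparison[OF _ \<delta>0], intro always_eventually allI)
    fix n
    have "h n /\<^sub>R norm (h n) - \<omega> = (h n - norm (h n) *\<^sub>R \<omega>) /\<^sub>R norm (h n)"
      using h0[of n] by (simp add: scaleR_diff_right)
    then have "norm (h n /\<^sub>R norm (h n) - \<omega>) = norm (h n - norm (h n) *\<^sub>R \<omega>) / norm (h n)"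
      by (simp only: norm_scaleR abs_inverse abs_norm_cancel divide_inverse mult.commute)
    also have "\<dots> \<le> \<delta> n"
      using dir[of n] h0[of n] by (simp add: pos_divide_le_eq)
    finally show "norm (h n /\<^sub>R norm (h n) - \<omega>) \<le> \<delta> n" .
  qed
  have const: "borel_loc_integrable (\<lambda>_::'a. lam)"
    by (rule borel_loc_integrable_const)
  have "AE x in lborel. 0 \<le> lam - g x \<bullet> \<omega>"
  proof (rule AE_nonneg_if_test_integrals_nonneg)
    show "borel_loc_integrable (\<lambda>x. lam - g x \<bullet> \<omega>)"
      by (intro borel_loc_integrable_diff borel_loc_integrable_inner g const)
    fix \<phi> :: "'a \<Rightarrow> real"
    assume \<phi>: "test_function \<phi>" and \<phi>0: "\<And>x. 0 \<le> \<phi> x"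
    have m: "\<phi> \<in> borel_measurable borel"
      by (rule borel_measurable_continuous_onI[OF test_function_continuous[OF \<phi>]])
    obtain C' r where C': "\<And>x. \<bar>\<phi> x\<bar> \<le> C' * indicator (cball 0 r) x"
      using test_function_bound[OF \<phi>] by blast
    define C where "C = \<bar>C'\<bar>"
    have C0: "0 \<le> C" by (simp add: C_def)
    have C: "\<bar>\<phi> x\<bar> \<le> C * indicator (cball 0 r) x" for x
      using C'[of x] by (auto simp: C_def indicator_def)
    let ?L = "\<integral>x. \<phi> x * (g x \<bullet> \<omega>) \<partial>lborel"
    let ?T = "\<lambda>R. \<integral>x. indicator (cball 0 (r + 1)) x * excess R x \<partial>lborel"
    have bound: "?L \<le> lam * (\<integral>x. \<phi> x \<partial>lborel) + C * ?T R" if R: "0 \<le> R" for R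
    proof (rule LIMSEQ_le[OF test_integral_tendsto[OF \<phi> h0 _ h_lim dir_lim]])
      show "norm (h n) \<le> 1" for n using h1[of n] \<delta>(2)[of n] by simp
      have "(\<lambda>n. lam * (\<integral>x. \<phi> x \<partial>lborel) + R * C * \<delta> n + C * ?T R)
          \<longlonglongrightarrow> lam * (\<integral>x. \<phi> x \<partial>lborel) + R * C * 0 + C * ?T R"
        by (intro tendsto_intros \<delta>0)
      then show "(\<lambda>n. lam * (\<integral>x. \<phi> x \<partial>lborel) + R * C * \<delta> n + C * ?T R)
          \<longlonglongrightarrow> lam * (\<integral>x. \<phi> x \<partial>lborel) + C * ?T R"
        by simp
      have "(\<integral>x. \<phi> x * (u (x + h n) - u x) \<partial>lborel) / norm (h n) \<le>
          lam * (\<integral>x. \<phi> x \<partial>lborel) + R * C * \<delta> n + C * ?T R" for n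
      proof -
        have "norm (h n) \<le> 1" using h1[of n] \<delta>(2)[of n] by simp
        from test_integral_difference_le[OF \<phi> \<phi>0 C C0 this lam R less_imp_le[OF \<delta>(1)] less_imp_le[OF small]]
        show ?thesis using h0[of n] by (simp add: pos_divide_le_eq mult.commute)
      qed
      then show "\<exists>N. \<forall>n\<ge>N. (\<integral>x. \<phi> x * (u (x + h n) - u x) \<partial>lborel) / norm (h n) \<le>
          lam * (\<integral>x. \<phi> x \<partial>lborel) + R * C * \<delta> n + C * ?T R"
        by blast
    qed
    have "(\<lambda>n. ?T (real n)) \<longlonglongrightarrow> (\<integral>x. 0 \<partial>(lborel :: 'a measure))"
    proof (rule integral_dominated_convergence)
      show "integrable lborel (\<lambda>x. norm (indicator (cball 0 (r + 1)) x *\<^sub>R g x))"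
        using g by (intro integrable_norm) (simp add: borel_loc_integrable_def)
      show "AE x in lborel. norm (indicator (cball 0 (r + 1)) x * excess (real n) x) \<le>
          norm (indicator (cball 0 (r + 1)) x *\<^sub>R g x)" for n
        by (auto simp: indicator_def excess_def)
      show "AE x in lborel. (\<lambda>n. indicator (cball 0 (r + 1)) x * excess (real n) x) \<longlonglongrightarrow> 0"
      \<comment> \<open>At each point the excess is exactly 0 once \<open>n\<close> reaches
        \<open>norm (g x)\<close>.\<close>
      proof (intro AE_I2 tendsto_mult_right_zero)
        fix x
        obtain N where N: "norm (g x) \<le> real N" using real_arch_simple by blast
        show "(\<lambda>n. excess (real n) x) \<longlonglongrightarrow> 0"
          by (rule Lim_transform_eventually[OF tendsto_const], rule eventually_mono[OF eventually_ge_at_top[of N]])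
            (use N in \<open>auto simp: excess_def\<close>)
      qed
      show "(\<lambda>x. indicator (cball 0 (r + 1)) x * excess (real n) x) \<in> borel_measurable lborel" for n
        using borel_loc_integrable_measurable[OF borel_loc_integrable_excess[of "real n"]]
        by (intro borel_measurable_times borel_measurable_indicator) auto
    qed simp
    then have "(\<lambda>n. lam * (\<integral>x. \<phi> x \<partial>lborel) + C * ?T (real n)) \<longlonglongrightarrow> lam * (\<integral>x. \<phi> x \<partial>lborel) + C * 0"
      by (intro tendsto_intros) simp
    then have "?L \<le> lam * (\<integral>x. \<phi> x \<partial>lborel) + C * 0"
      by (rule LIMSEQ_le_const) (use bound in auto)
    moreover have "(\<integral>x. \<phi> x * (lam - g x \<bullet> \<omega>) \<partial>lborel) = (\<integral>x. \<phi> x *\<^sub>R lam \<partial>lborel) - (\<integral>x. \<phi> x *\<^sub>R (g x \<bullet> \<omega>) \<partial>lborel)"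
      using Bochner_Integration.integral_diff[OF integrable_mult_borel_loc_integrable[OF const m C]
          integrable_mult_borel_loc_integrable[OF borel_loc_integrable_inner[OF g, of \<omega>] m C]]
      by (simp only: right_diff_distrib real_scaleR_def)
    ultimately show "0 \<le> (\<integral>x. \<phi> x * (lam - g x \<bullet> \<omega>) \<partial>lborel)"
      by (simp add: mult.commute)
  qed
  then show ?thesis by eventually_elim simp
qed

text \<open>Countability lets a single null set serve all \<open>d\<close> in \<open>D\<close>. The
  homogeneous form \<open>g x \<bullet> d \<le> lam * norm d\<close> allows a dense subset of the
  whole space in place of the sphere: its violation is an open condition on \<open>d\<close>, and if
  \<open>norm (g x)\<close> exceeded \<open>lam\<close> it would hold at
  \<open>d = g x\<close>.\<close>

corollary AE_gradient_norm_le: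
  assumes lam: "0 \<le> lam"
    and fin: "(\<integral>\<^sup>+h. ennreal (1 / norm h ^ DIM('a)) *
      emeasure lborel {x. lam * norm h < \<bar>u (x + h) - u x\<bar>} \<partial>lborel) < \<infinity>"
  shows "AE x in lborel. norm (g x) \<le> lam"
proof -
  obtain D :: "'a set" where D: "countable D" "\<And>X. open X \<Longrightarrow> X \<noteq> {} \<Longrightarrow> \<exists>d\<in>D. d \<in> X"
    by (rule countable_dense_setE) blast
  have "AE x in lborel. g x \<bullet> d \<le> lam * norm d" for d
  proof (cases "d = 0")
    case False
    have "norm (d /\<^sub>R norm d) = 1" using False by simp
    from AE_gradient_direction_le[OF lam this fin] show ?thesis
      by eventually_elim (use False in \<open>simp add: field_simps\<close>)
  qed simp
  then have "AE x in lborel. \<forall>d\<in>D. g x \<bullet> d \<le> lam * norm d"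
    by (simp add: AE_ball_countable[OF D(1)])
  then show ?thesis
  proof eventually_elim
    case (elim x)
    show ?case
    proof (rule ccontr)
      assume "\<not> norm (g x) \<le> lam"
      then have "lam * norm (g x) < norm (g x) * norm (g x)"
        using lam by (intro mult_strict_right_mono) auto
      then have "g x \<in> {d. lam * norm d < g x \<bullet> d}"
        by (simp add: dot_square_norm power2_eq_square)
      moreover have "open {d. lam * norm d < g x \<bullet> d}"
        by (intro open_Collect_less continuous_intros)
      ultimately obtain d where "d \<in> D" "lam * norm d < g x \<bullet> d"
        using D(2) by blast
      with elim show False by force
    qed
  qed
qed

end

section \<open>Borel representatives and the final identity\<close>

lemma loc_integrable_measurable:
  fixes f :: "'a::euclidean_space \<Rightarrow> 'b::{banach, second_countable_topology}"
  assumes "loc_integrable f"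
  shows "f \<in> borel_measurable lebesgue"
proof (rule borel_measurable_LIMSEQ_metric)
  show "(\<lambda>x. indicator (cball 0 (real n)) x *\<^sub>R f x) \<in> borel_measurable lebesgue" for n
    using assms by (intro borel_measurable_integrable) (simp add: loc_integrable_def set_integrable_def)
  fix x :: 'a
  obtain N where N: "norm x \<le> real N" using real_arch_simple by blast
  show "(\<lambda>n. indicator (cball 0 (real n)) x *\<^sub>R f x) \<longlonglongrightarrow> f x"
    by (rule Lim_transform_eventually[OF tendsto_const], rule eventually_mono[OF eventually_ge_at_top[of N]])
      (use N in \<open>auto simp: indicator_def\<close>)
qed

lemma borel_representative_euclidean:
  fixes g :: "'a::euclidean_space \<Rightarrow> 'b::euclidean_space"
  assumes g: "g \<in> borel_measurable lebesgue"
  obtains g' where "g' \<in> borel_measurable borel" "AE x in lborel. g x = g' x"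
proof -
  have "\<exists>f\<in>borel_measurable lborel. AE x in lborel. g x \<bullet> b = f x" for b
    by (intro completion_ex_borel_measurable_real borel_measurable_inner g borel_measurable_const)
  then obtain f where f[measurable]: "\<And>b. f b \<in> borel_measurable lborel"
    and eq: "\<And>b. AE x in lborel. g x \<bullet> b = f b x"
    by metis
  show ?thesis
  proof
    show "(\<lambda>x. \<Sum>b\<in>Basis. f b x *\<^sub>R b) \<in> borel_measurable borel"
      using f by measurable
    have "AE x in lborel. \<forall>b\<in>Basis. g x \<bullet> b = f b x"
      using eq by (simp add: AE_finite_all)
    then show "AE x in lborel. g x = (\<Sum>b\<in>Basis. f b x *\<^sub>R b)"
    proof eventually_elim
      case (elim x)
      have "g x = (\<Sum>b\<in>Basis. (g x \<bullet> b) *\<^sub>R b)" by (simp add: euclidean_representation)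
      with elim show ?case by simp
    qed
  qed
qed

lemma borel_loc_integrable_representative:
  fixes f f' :: "'a::euclidean_space \<Rightarrow> 'b::{banach, second_countable_topology}"
  assumes f: "loc_integrable f" and f': "f' \<in> borel_measurable borel"
    and eq: "AE x in lborel. f x = f' x"
  shows "borel_loc_integrable f'"
  unfolding borel_loc_integrable_def
proof (intro conjI allI)
  fix r
  have "AE x in lebesgue. indicator (cball 0 r) x *\<^sub>R f x = indicator (cball 0 r) x *\<^sub>R f' x"
    using AE_completion[OF eq] by eventually_elim simp
  moreover have "integrable lebesgue (\<lambda>x. indicator (cball 0 r) x *\<^sub>R f x)"
    using f by (auto simp: loc_integrable_def set_integrable_def)
  moreover have m: "(\<lambda>x. indicator (cball 0 r) x *\<^sub>R f' x) \<in> borel_measurable lborel"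
    by (intro borel_measurable_scaleR borel_measurable_indicator) (use f' in auto)
  ultimately have "integrable lebesgue (\<lambda>x. indicator (cball 0 r) x *\<^sub>R f' x)"
    using integrable_cong_AE_imp measurable_completion by blast
  then show "integrable lborel (\<lambda>x. indicator (cball 0 r) x *\<^sub>R f' x)"
    using integrable_completion[OF m] by simp
qed fact

lemma integral_lebesgue_representative:
  fixes f f' :: "'a::euclidean_space \<Rightarrow> real"
  assumes f: "f \<in> borel_measurable lebesgue" and f': "f' \<in> borel_measurable borel"
    and eq: "AE x in lborel. f x = f' x"
  shows "(\<integral>x. f x \<partial>lebesgue) = (\<integral>x. f' x \<partial>lborel)"
proof -
  have m: "f' \<in> borel_measurable lborel" using f' by simp
  have "(\<integral>x. f x \<partial>lebesgue) = (\<integral>x. f' x \<partial>lebesgue)"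
    by (intro integral_cong_AE f measurable_completion m AE_completion eq)
  also have "\<dots> = (\<integral>x. f' x \<partial>lborel)"
    by (rule integral_completion[OF m])
  finally show ?thesis .
qed

lemma borel_weak_gradient_representative:
  fixes u u' :: "'a::euclidean_space \<Rightarrow> real" and g g' :: "'a \<Rightarrow> 'a"
  assumes u: "loc_integrable u" and g: "loc_integrable g" and weak: "weak_gradient u g"
    and u'[measurable]: "u' \<in> borel_measurable borel" and uu': "AE x in lborel. u x = u' x"
    and g'[measurable]: "g' \<in> borel_measurable borel" and gg': "AE x in lborel. g x = g' x"
  shows "borel_weak_gradient u' g'"
proof
  show "borel_loc_integrable u'" "borel_loc_integrable g'"
    by (rule borel_loc_integrable_representative[OF u u' uu'] borel_loc_integrable_representative[OF g g' gg'])+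
  fix \<phi> :: "'a \<Rightarrow> real" and i :: 'a
  assume \<phi>: "test_function \<phi>" and i: "i \<in> Basis"
  have [measurable]: "\<phi> \<in> borel_measurable borel" "(\<lambda>x. frechet_derivative \<phi> (at x) i) \<in> borel_measurable borel"
    using test_function_continuous[OF \<phi>] test_function_directional_derivative(1)[OF \<phi>]
    by (auto intro: borel_measurable_continuous_onI)
  have [measurable]: "\<phi> \<in> borel_measurable lebesgue" "(\<lambda>x. frechet_derivative \<phi> (at x) i) \<in> borel_measurable lebesgue"
    by (auto intro: measurable_completion)
  note [measurable] = loc_integrable_measurable[OF u] loc_integrable_measurable[OF g]
  have "(\<integral>x. u' x * frechet_derivative \<phi> (at x) i \<partial>lborel) = (\<integral>x. u x * frechet_derivative \<phi> (at x) i \<partial>lebesgue)"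
    by (rule integral_lebesgue_representative[symmetric]) (use uu' in auto)
  also have "\<dots> = - (\<integral>x. (g x \<bullet> i) * \<phi> x \<partial>lebesgue)"
    using weak \<phi> i by (simp add: weak_gradient_def)
  also have "(\<integral>x. (g x \<bullet> i) * \<phi> x \<partial>lebesgue) = (\<integral>x. (g' x \<bullet> i) * \<phi> x \<partial>lborel)"
    by (rule integral_lebesgue_representative) (use gg' in auto)
  finally show "(\<integral>x. u' x * frechet_derivative \<phi> (at x) i \<partial>lborel) = - (\<integral>x. (g' x \<bullet> i) * \<phi> x \<partial>lborel)" .
qed

theorem theorem1p5:
  fixes u :: "'a::euclidean_space \<Rightarrow> real" and g :: "'a \<Rightarrow> 'a"
  assumes "loc_integrable u" and "loc_integrable g" and "weak_gradient u g"
  shows "esssup lebesgue (\<lambda>x. ereal (norm (g x))) =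
         Inf (ereal ` {lam. lam > 0 \<and> nu0 (E_lam0 u lam) < \<infinity>})"
proof -
  let ?f = "\<lambda>x. ereal (norm (g x))"
  note u_meas = loc_integrable_measurable[OF assms(1)]
  note g_meas = loc_integrable_measurable[OF assms(2)]
  have f: "?f \<in> borel_measurable lebesgue" using g_meas by measurable
  obtain u' where u': "u' \<in> borel_measurable borel" "AE x in lborel. u x = u' x"
    using borel_representative_euclidean[OF u_meas] by blast
  obtain g' where g': "g' \<in> borel_measurable borel" "AE x in lborel. g x = g' x"
    using borel_representative_euclidean[OF g_meas] by blast
  interpret borel_weak_gradient u' g'
    by (rule borel_weak_gradient_representative[OF assms u' g'])
  note nu = nu0_eq[OF u_meas u']
  show ?thesis
  proof (rule antisym)
    show "esssup lebesgue ?f \<le> Inf (ereal ` {lam. lam > 0 \<and> nu0 (E_lam0 u lam) < \<infinity>})"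
    proof (rule Inf_greatest, clarify)
      fix lam :: real
      assume lam: "0 < lam" "nu0 (E_lam0 u lam) < \<infinity>"
      from lam(1) have "0 \<le> lam" by simp
      from AE_gradient_norm_le[OF this lam(2)[unfolded nu]] g'(2)
      have "AE x in lborel. ?f x \<le> ereal lam" by eventually_elim simp
      then show "esssup lebesgue ?f \<le> ereal lam"
        by (intro esssup_I f AE_completion)
    qed
    show "Inf (ereal ` {lam. lam > 0 \<and> nu0 (E_lam0 u lam) < \<infinity>}) \<le> esssup lebesgue ?f"
    \<comment> \<open>The essential supremum may be 0 or infinite and so need not be a candidate for
      the infimum. Real \<open>lam\<close> strictly above it are used instead; if it is infinite
      there is nothing to show.\<close>
    proof (rule dense_ge)
      fix y assume "esssup lebesgue ?f < y"
      then obtain lam where lam: "esssup lebesgue ?f < ereal lam" "ereal lam < y"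
        using ereal_dense2 by blast
      \<comment> \<open>Comparison with the zero function shows that the essential supremum is
        nonnegative, which makes \<open>lam\<close> strictly positive as the infimum
        demands.\<close>
      have "esssup lebesgue (\<lambda>_::'a. 0 :: ereal) = 0"
        by (rule esssup_const) simp
      moreover have "esssup lebesgue (\<lambda>_::'a. 0 :: ereal) \<le> esssup lebesgue ?f"
        by (rule esssup_mono) auto
      ultimately have pos: "0 < lam" using lam(1) by (metis ereal_less(2) le_less_trans)
      have "AE x in lborel. ?f x \<le> esssup lebesgue ?f"
        using esssup_AE[of ?f lebesgue] by (simp add: AE_completion_iff)
      with g'(2) have "AE x in lborel. norm (g' x) \<le> lam"
      proof eventually_elim
        case (elim x)
        then have "ereal (norm (g' x)) \<le> ereal lam" using lam(1) by (metis less_imp_le order_trans)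
        then show ?case by simp
      qed
      then have "AE x in lborel. \<bar>u' (x + h) - u' x\<bar> \<le> lam * norm h" for h
        by (rule AE_difference_le) (use pos in simp)
      then have "emeasure lborel {x. lam * norm h < \<bar>u' (x + h) - u' x\<bar>} = 0" for h
        by (subst AE_iff_measurable[of _ _ "\<lambda>x. \<bar>u' (x + h) - u' x\<bar> \<le> lam * norm h", symmetric])
          (auto simp: not_le)
      then have "nu0 (E_lam0 u lam) = 0" by (simp add: nu)
      with pos have "Inf (ereal ` {lam. lam > 0 \<and> nu0 (E_lam0 u lam) < \<infinity>}) \<le> ereal lam"
        by (intro Inf_lower) auto
      with lam(2) show "Inf (ereal ` {lam. lam > 0 \<and> nu0 (E_lam0 u lam) < \<infinity>}) \<le> y"
        by simp
    qed
  qed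
qed

end
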